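(* There is an absolute constant $C$ such that for all positive integers $n$ and $k$ there is a CNF encoding of $\mathsf{AtMostK}(x_1,\dots,x_n)$ using at most $4n + C\sqrt[3]{kn^2}$ clauses and at most $C\sqrt[3]{kn^2}$ auxiliary variables (i.e. $4n + O(\sqrt[3]{kn^2})$ clauses and $O(\sqrt[3]{kn^2})$ auxiliary variables).
   Context: $\mathsf{AtMostK}(x_1,\dots,x_n)$ is true iff at most $k$ of $x_1,\dots,x_n$ are true. A CNF formula is a set of clauses; its size is its number of clauses. For a partial assignment $\tau$, $\varphi|_\tau$ deletes clauses satisfied by $\tau$ and literals falsified by $\tau$. A CNF $\varphi$ over $X\sqcup Y$, $X=(x_1,\dots,x_n)$, encodes $f$ if for every assignment $\tau$ of $X$, $f(\tau)=\top$ iff $\varphi|_\tau$ is satisfiable; variables in $Y$ are auxiliary. *)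

theory Defs
  imports Complex_Main
begin

datatype 'v literal = Pos 'v | Neg 'v

fun lit_var :: "'v literal \<Rightarrow> 'v" where
  "lit_var (Pos v) = v"
| "lit_var (Neg v) = v"

type_synonym 'v clause = "'v literal set"

type_synonym 'v cnf = "'v clause set"

definition vars :: "'v cnf \<Rightarrow> 'v set" where
  "vars \<phi> = (\<Union>c\<in>\<phi>. lit_var ` c)"

fun lit_value :: "('v \<rightharpoonup> bool) \<Rightarrow> 'v literal \<rightharpoonup> bool" where
  "lit_value \<tau> (Pos v) = \<tau> v"
| "lit_value \<tau> (Neg v) = map_option Not (\<tau> v)"

definition restrict_cnf :: "'v cnf \<Rightarrow> ('v \<rightharpoonup> bool) \<Rightarrow> 'v cnf" where
  "restrict_cnf \<phi> \<tau> =
     {{l \<in> c. lit_value \<tau> l \<noteq> Some False} | c.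
        c \<in> \<phi> \<and> \<not> (\<exists>l\<in>c. lit_value \<tau> l = Some True)}"

definition satisfiable :: "'v cnf \<Rightarrow> bool" where
  "satisfiable \<phi> \<longleftrightarrow>
     (\<exists>\<sigma> :: 'v \<Rightarrow> bool. \<forall>c\<in>\<phi>. \<exists>l\<in>c. lit_value (\<lambda>v. Some (\<sigma> v)) l = Some True)"

text \<open>
  The list \<open>xs\<close> is the tuple \<open>X\<close> of input variables, and a Boolean function of
  \<open>n\<close> arguments is represented by its values on lists of length \<open>n\<close>.
  Finiteness of \<open>\<phi>\<close> and \<open>Y\<close> is required explicitly because \<open>card\<close> is \<open>0\<close> on infinite sets.
\<close>

definition encodes :: "'v cnf \<Rightarrow> 'v list \<Rightarrow> 'v set \<Rightarrow> (bool list \<Rightarrow> bool) \<Rightarrow> bool" where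
  "encodes \<phi> xs Y f \<longleftrightarrow>
     finite \<phi> \<and> finite Y \<and> distinct xs \<and> set xs \<inter> Y = {} \<and> vars \<phi> \<subseteq> set xs \<union> Y \<and>
     (\<forall>\<tau> :: 'v \<rightharpoonup> bool. dom \<tau> = set xs \<longrightarrow>
        (f (map (\<lambda>x. the (\<tau> x)) xs) \<longleftrightarrow> satisfiable (restrict_cnf \<phi> \<tau>)))"

definition at_most :: "nat \<Rightarrow> bool list \<Rightarrow> bool" where
  "at_most k bs \<longleftrightarrow> card {i. i < length bs \<and> bs ! i} \<le> k"

end

theory Submission
  imports Defs "HOL-Library.FuncSet"
begin

text \<open>
  Let \<open>t\<close> be about the cube root of \<open>n / k\<close> and cut the inputs into blocks of length \<open>t\<close>.
  Take \<open>O(k t)\<close> slots of \<open>t\<close> wires each, and let three hash functions offer three slots to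
  every block. Each block containing a true input selects one of its slots (one clause per
  input), into which its inputs are copied (three clauses per input), and no slot is selected
  twice; then at most \<open>k\<close> inputs are true iff at most \<open>k\<close> wires are, for a suitable selection.
  A suitable selection exists because for random hash functions any \<open>s \<le> k\<close> blocks are offered
  at least \<open>s\<close> slots between them, so Hall's theorem applies. The remaining constraints are
  cardinality constraints on \<open>O(k t\<^sup>2)\<close> variables in total, for which a chain of adders gives
  encodings of linear size, and \<open>k t\<^sup>2\<close> is at most the cube root of \<open>k n\<^sup>2\<close>.
\<close>

section \<open>Encodable predicates\<close>

text \<open>The body of \<open>satisfiable\<close> with the assignment exposed, so that it can be
  altered on auxiliary variables only.\<close>

definition models :: "('v \<Rightarrow> bool) \<Rightarrow> 'v cnf \<Rightarrow> bool" where
  "models \<sigma> \<phi> \<longleftrightarrow> (\<forall>c\<in>\<phi>. \<exists>l\<in>c. lit_value (\<lambda>v. Some (\<sigma> v)) l = Some True)"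

lemma models_cong:
  assumes "\<And>v. v \<in> vars \<phi> \<Longrightarrow> \<sigma> v = \<sigma>' v"
  shows "models \<sigma> \<phi> \<longleftrightarrow> models \<sigma>' \<phi>"
proof -
  have "lit_value (\<lambda>v. Some (\<sigma> v)) l = lit_value (\<lambda>v. Some (\<sigma>' v)) l" if "c \<in> \<phi>" "l \<in> c" for c l
  proof -
    have "lit_var l \<in> vars \<phi>" using that by (auto simp: vars_def)
    then show ?thesis using assms by (cases l) auto
  qed
  then show ?thesis unfolding models_def by (metis (no_types, lifting))
qed

lemma models_Un: "models \<sigma> (\<phi> \<union> \<psi>) \<longleftrightarrow> models \<sigma> \<phi> \<and> models \<sigma> \<psi>"
  by (auto simp: models_def)

lemma vars_Un: "vars (\<phi> \<union> \<psi>) = vars \<phi> \<union> vars \<psi>"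
  by (auto simp: vars_def)

text \<open>
  Quantifying over the set \<open>A\<close> to be avoided allows encodings to be combined
  without clashes of auxiliary variables.
\<close>

definition encodable :: "nat set \<Rightarrow> ((nat \<Rightarrow> bool) \<Rightarrow> bool) \<Rightarrow> nat \<Rightarrow> nat \<Rightarrow> bool" where
  "encodable V P c a \<longleftrightarrow> finite V \<and>
     (\<forall>A. finite A \<longrightarrow> (\<exists>\<phi> Y. finite \<phi> \<and> finite Y \<and> card \<phi> \<le> c \<and> card Y \<le> a \<and>
        Y \<inter> A = {} \<and> vars \<phi> \<subseteq> V \<union> Y \<and>
        (\<forall>\<sigma>. P \<sigma> \<longleftrightarrow> (\<exists>\<sigma>'. (\<forall>v. v \<notin> Y \<longrightarrow> \<sigma>' v = \<sigma> v) \<and> models \<sigma>' \<phi>))))"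

lemma encodableE:
  assumes "encodable V P c a" "finite A"
  obtains \<phi> Y where "finite \<phi>" "finite Y" "card \<phi> \<le> c" "card Y \<le> a" "Y \<inter> A = {}"
    "vars \<phi> \<subseteq> V \<union> Y"
    "\<forall>\<sigma>. P \<sigma> \<longleftrightarrow> (\<exists>\<sigma>'. (\<forall>v. v \<notin> Y \<longrightarrow> \<sigma>' v = \<sigma> v) \<and> models \<sigma>' \<phi>)"
proof -
  from assms have "\<exists>\<phi> Y. finite \<phi> \<and> finite Y \<and> card \<phi> \<le> c \<and> card Y \<le> a \<and>
      Y \<inter> A = {} \<and> vars \<phi> \<subseteq> V \<union> Y \<and>
      (\<forall>\<sigma>. P \<sigma> \<longleftrightarrow> (\<exists>\<sigma>'. (\<forall>v. v \<notin> Y \<longrightarrow> \<sigma>' v = \<sigma> v) \<and> models \<sigma>' \<phi>))"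
    unfolding encodable_def by simp
  then show ?thesis by (elim exE conjE) (rule that)
qed

lemma encodable_mono:
  assumes "encodable V P c a" "c \<le> c'" "a \<le> a'" "V \<subseteq> V'" "finite V'"
  shows "encodable V' P c' a'"
  unfolding encodable_def
proof (intro conjI allI impI)
  fix A :: "nat set" assume "finite A"
  then obtain \<phi> Y where *: "finite \<phi>" "finite Y" "card \<phi> \<le> c" "card Y \<le> a" "Y \<inter> A = {}"
    "vars \<phi> \<subseteq> V \<union> Y"
    "\<forall>\<sigma>. P \<sigma> \<longleftrightarrow> (\<exists>\<sigma>'. (\<forall>v. v \<notin> Y \<longrightarrow> \<sigma>' v = \<sigma> v) \<and> models \<sigma>' \<phi>)"
    by (rule encodableE[OF assms(1)])
  show "\<exists>\<phi> Y. finite \<phi> \<and> finite Y \<and> card \<phi> \<le> c' \<and> card Y \<le> a' \<and>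
        Y \<inter> A = {} \<and> vars \<phi> \<subseteq> V' \<union> Y \<and>
        (\<forall>\<sigma>. P \<sigma> \<longleftrightarrow> (\<exists>\<sigma>'. (\<forall>v. v \<notin> Y \<longrightarrow> \<sigma>' v = \<sigma> v) \<and> models \<sigma>' \<phi>))"
    by (intro exI[of _ \<phi>] exI[of _ Y] conjI *(7)) (use *(1-6) assms(2-4) in auto)
qed (use assms in simp)

text \<open>The auxiliary sets are chosen disjoint from each other and from \<open>V\<close> and
  \<open>W\<close>. Neither formula then mentions the other's auxiliary variables, and satisfying
  assignments can be glued.\<close>

lemma encodable_conj:
  assumes P: "encodable V P c a" and Q: "encodable W Q d b"
  shows "encodable (V \<union> W) (\<lambda>\<sigma>. P \<sigma> \<and> Q \<sigma>) (c + d) (a + b)"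
  unfolding encodable_def
proof (intro conjI allI impI)
  have fin: "finite V" "finite W" using P Q by (auto simp: encodable_def)
  then show "finite (V \<union> W)" by simp
  fix A :: "nat set" assume A: "finite A"
  obtain \<phi> Y where 1: "finite \<phi>" "finite Y" "card \<phi> \<le> c" "card Y \<le> a" "Y \<inter> (A \<union> V \<union> W) = {}"
    "vars \<phi> \<subseteq> V \<union> Y"
    and P1: "\<forall>\<sigma>. P \<sigma> \<longleftrightarrow> (\<exists>\<sigma>'. (\<forall>v. v \<notin> Y \<longrightarrow> \<sigma>' v = \<sigma> v) \<and> models \<sigma>' \<phi>)"
    by (rule encodableE[OF P finite_UnI[OF finite_UnI[OF A fin(1)] fin(2)]])
  note P1 = spec[OF P1]
  obtain \<psi> Z where 2: "finite \<psi>" "finite Z" "card \<psi> \<le> d" "card Z \<le> b" "Z \<inter> (A \<union> V \<union> W \<union> Y) = {}"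
    "vars \<psi> \<subseteq> W \<union> Z"
    and Q1: "\<forall>\<sigma>. Q \<sigma> \<longleftrightarrow> (\<exists>\<sigma>'. (\<forall>v. v \<notin> Z \<longrightarrow> \<sigma>' v = \<sigma> v) \<and> models \<sigma>' \<psi>)"
    by (rule encodableE[OF Q finite_UnI[OF finite_UnI[OF finite_UnI[OF A fin(1)] fin(2)] 1(2)]])
  note Q1 = spec[OF Q1]
  have iff: "(P \<sigma> \<and> Q \<sigma>) \<longleftrightarrow> (\<exists>\<sigma>'. (\<forall>v. v \<notin> Y \<union> Z \<longrightarrow> \<sigma>' v = \<sigma> v) \<and> models \<sigma>' (\<phi> \<union> \<psi>))" for \<sigma>
  proof
    assume "P \<sigma> \<and> Q \<sigma>"
    then have "P \<sigma>" "Q \<sigma>" by simp_all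
    obtain \<sigma>1 where s1: "\<forall>v. v \<notin> Y \<longrightarrow> \<sigma>1 v = \<sigma> v" "models \<sigma>1 \<phi>"
      using P1[THEN iffD1, OF \<open>P \<sigma>\<close>] by (elim exE conjE)
    obtain \<sigma>2 where s2: "\<forall>v. v \<notin> Z \<longrightarrow> \<sigma>2 v = \<sigma> v" "models \<sigma>2 \<psi>"
      using Q1[THEN iffD1, OF \<open>Q \<sigma>\<close>] by (elim exE conjE)
    define \<sigma>' where "\<sigma>' v = (if v \<in> Y then \<sigma>1 v else if v \<in> Z then \<sigma>2 v else \<sigma> v)" for v
    have "\<sigma>1 v = \<sigma>' v" if "v \<in> vars \<phi>" for v
      using that 1(5,6) 2(5) s1(1) unfolding \<sigma>'_def by (cases "v \<in> Y") auto
    with s1(2) have "models \<sigma>' \<phi>" using models_cong[of \<phi> \<sigma>1 \<sigma>'] by simp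
    moreover have "\<sigma>2 v = \<sigma>' v" if "v \<in> vars \<psi>" for v
      using that 1(5) 2(5,6) s2(1) unfolding \<sigma>'_def by (cases "v \<in> Z") auto
    with s2(2) have "models \<sigma>' \<psi>" using models_cong[of \<psi> \<sigma>2 \<sigma>'] by simp
    moreover have "\<forall>v. v \<notin> Y \<union> Z \<longrightarrow> \<sigma>' v = \<sigma> v" by (simp add: \<sigma>'_def)
    ultimately show "\<exists>\<sigma>'. (\<forall>v. v \<notin> Y \<union> Z \<longrightarrow> \<sigma>' v = \<sigma> v) \<and> models \<sigma>' (\<phi> \<union> \<psi>)"
      unfolding models_Un by blast
  next
    assume "\<exists>\<sigma>'. (\<forall>v. v \<notin> Y \<union> Z \<longrightarrow> \<sigma>' v = \<sigma> v) \<and> models \<sigma>' (\<phi> \<union> \<psi>)"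
    then obtain \<sigma>' where s: "\<forall>v. v \<notin> Y \<union> Z \<longrightarrow> \<sigma>' v = \<sigma> v" "models \<sigma>' \<phi>" "models \<sigma>' \<psi>"
      unfolding models_Un by blast
    \<comment> \<open>Values on \<open>Z\<close> can be reset to those of \<open>\<sigma>\<close>,
      because no variable of \<open>Z\<close> occurs in \<open>\<phi>\<close>.\<close>
    have "\<sigma>' v = (if v \<in> Y then \<sigma>' v else \<sigma> v)" if "v \<in> vars \<phi>" for v
      using that 1(5,6) 2(5) s(1) by (cases "v \<in> Y") auto
    with s(2) have "models (\<lambda>v. if v \<in> Y then \<sigma>' v else \<sigma> v) \<phi>"
      using models_cong[of \<phi> \<sigma>' "\<lambda>v. if v \<in> Y then \<sigma>' v else \<sigma> v"] by simp
    then have "P \<sigma>" by (intro P1[THEN iffD2] exI[of _ "\<lambda>v. if v \<in> Y then \<sigma>' v else \<sigma> v"]) simp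
    have "\<sigma>' v = (if v \<in> Z then \<sigma>' v else \<sigma> v)" if "v \<in> vars \<psi>" for v
      using that 1(5) 2(5,6) s(1) by (cases "v \<in> Z") auto
    with s(3) have "models (\<lambda>v. if v \<in> Z then \<sigma>' v else \<sigma> v) \<psi>"
      using models_cong[of \<psi> \<sigma>' "\<lambda>v. if v \<in> Z then \<sigma>' v else \<sigma> v"] by simp
    then have "Q \<sigma>" by (intro Q1[THEN iffD2] exI[of _ "\<lambda>v. if v \<in> Z then \<sigma>' v else \<sigma> v"]) simp
    with \<open>P \<sigma>\<close> show "P \<sigma> \<and> Q \<sigma>" by simp
  qed
  have "card (\<phi> \<union> \<psi>) \<le> c + d" "card (Y \<union> Z) \<le> a + b"
    using card_Un_le[of \<phi> \<psi>] card_Un_le[of Y Z] 1 2 by linarith+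
  then show "\<exists>\<phi> Y. finite \<phi> \<and> finite Y \<and> card \<phi> \<le> c + d \<and> card Y \<le> a + b \<and>
        Y \<inter> A = {} \<and> vars \<phi> \<subseteq> V \<union> W \<union> Y \<and>
        (\<forall>\<sigma>. (P \<sigma> \<and> Q \<sigma>) \<longleftrightarrow> (\<exists>\<sigma>'. (\<forall>v. v \<notin> Y \<longrightarrow> \<sigma>' v = \<sigma> v) \<and> models \<sigma>' \<phi>))"
    by (intro exI[of _ "\<phi> \<union> \<psi>"] exI[of _ "Y \<union> Z"] conjI allI iff)
      (use 1(1,2,5,6) 2(1,2,5,6) in \<open>auto simp: vars_Un\<close>)
qed

lemma encodable_True: "finite V \<Longrightarrow> (\<And>\<sigma>. P \<sigma>) \<Longrightarrow> encodable V P 0 0"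
  unfolding encodable_def
  by (intro conjI allI impI, assumption, rule exI[of _ "{}"], rule exI[of _ "{}"])
    (auto simp: vars_def models_def)

lemma encodable_Ball:
  assumes "finite I" "\<And>i. i \<in> I \<Longrightarrow> encodable (V i) (P i) (c i) (a i)"
  shows "encodable (\<Union>i\<in>I. V i) (\<lambda>\<sigma>. \<forall>i\<in>I. P i \<sigma>) (\<Sum>i\<in>I. c i) (\<Sum>i\<in>I. a i)"
  using assms
proof (induction I rule: finite_induct)
  case empty
  then show ?case by (simp add: encodable_True)
next
  case (insert i I)
  have "encodable (V i \<union> (\<Union>i\<in>I. V i)) (\<lambda>\<sigma>. P i \<sigma> \<and> (\<forall>i\<in>I. P i \<sigma>))
      (c i + (\<Sum>i\<in>I. c i)) (a i + (\<Sum>i\<in>I. a i))"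
    by (intro encodable_conj insert) (use insert in auto)
  then show ?case using insert by simp
qed

text \<open>Hides intermediate variables \<open>Z\<close>: they become auxiliary, hence the bound
  \<open>z + a\<close>. Both \<open>Z\<close> and \<open>P\<close> may depend on \<open>A\<close>,
  because \<open>Z\<close> has to be fresh.\<close>

lemma encodable_project:
  assumes "finite V"
  assumes ex: "\<And>A. finite A \<Longrightarrow> \<exists>Z P. finite Z \<and> Z \<inter> A = {} \<and> card Z \<le> z \<and>
     encodable (V \<union> Z) P c a \<and> (\<forall>\<sigma>. Q \<sigma> \<longleftrightarrow> (\<exists>\<sigma>'. (\<forall>v. v \<notin> Z \<longrightarrow> \<sigma>' v = \<sigma> v) \<and> P \<sigma>'))"
  shows "encodable V Q c (z + a)"
  unfolding encodable_def
proof (intro conjI allI impI)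
  fix A :: "nat set" assume A: "finite A"
  obtain Z P where Z: "finite Z" "Z \<inter> A = {}" "card Z \<le> z" "encodable (V \<union> Z) P c a"
    and Q: "\<forall>\<sigma>. Q \<sigma> \<longleftrightarrow> (\<exists>\<sigma>'. (\<forall>v. v \<notin> Z \<longrightarrow> \<sigma>' v = \<sigma> v) \<and> P \<sigma>')"
    using ex[OF A] by (elim exE conjE) (rule that)
  note Q = spec[OF Q]
  obtain \<phi> Y where 1: "finite \<phi>" "finite Y" "card \<phi> \<le> c" "card Y \<le> a" "Y \<inter> (A \<union> Z) = {}"
    "vars \<phi> \<subseteq> (V \<union> Z) \<union> Y"
    and P: "\<forall>\<sigma>. P \<sigma> \<longleftrightarrow> (\<exists>\<sigma>'. (\<forall>v. v \<notin> Y \<longrightarrow> \<sigma>' v = \<sigma> v) \<and> models \<sigma>' \<phi>)"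
    by (rule encodableE[OF Z(4) finite_UnI[OF A Z(1)]])
  note P = spec[OF P]
  have iff: "Q \<sigma> \<longleftrightarrow> (\<exists>\<sigma>'. (\<forall>v. v \<notin> Z \<union> Y \<longrightarrow> \<sigma>' v = \<sigma> v) \<and> models \<sigma>' \<phi>)" for \<sigma>
  proof
    assume "Q \<sigma>"
    obtain \<sigma>1 where s1: "\<forall>v. v \<notin> Z \<longrightarrow> \<sigma>1 v = \<sigma> v" "P \<sigma>1"
      using Q[THEN iffD1, OF \<open>Q \<sigma>\<close>] by (elim exE conjE)
    obtain \<sigma>2 where s2: "\<forall>v. v \<notin> Y \<longrightarrow> \<sigma>2 v = \<sigma>1 v" "models \<sigma>2 \<phi>"
      using P[THEN iffD1, OF s1(2)] by (elim exE conjE)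
    show "\<exists>\<sigma>'. (\<forall>v. v \<notin> Z \<union> Y \<longrightarrow> \<sigma>' v = \<sigma> v) \<and> models \<sigma>' \<phi>"
      by (rule exI[of _ \<sigma>2]) (simp add: s1 s2)
  next
    assume "\<exists>\<sigma>'. (\<forall>v. v \<notin> Z \<union> Y \<longrightarrow> \<sigma>' v = \<sigma> v) \<and> models \<sigma>' \<phi>"
    then obtain \<sigma>' where s: "\<forall>v. v \<notin> Z \<union> Y \<longrightarrow> \<sigma>' v = \<sigma> v" "models \<sigma>' \<phi>" by (elim exE conjE)
    have "P (\<lambda>v. if v \<in> Y then \<sigma> v else \<sigma>' v)"
      by (intro P[THEN iffD2] exI[of _ \<sigma>']) (simp add: s)
    moreover have "(if v \<in> Y then \<sigma> v else \<sigma>' v) = \<sigma> v" if "v \<notin> Z" for v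
      using s(1) that by simp
    ultimately show "Q \<sigma>"
      by (intro Q[THEN iffD2] exI[of _ "\<lambda>v. if v \<in> Y then \<sigma> v else \<sigma>' v"]) simp
  qed
  have "card (Z \<union> Y) \<le> z + a" using card_Un_le[of Z Y] 1(4) Z(3) by linarith
  then show "\<exists>\<phi> Y. finite \<phi> \<and> finite Y \<and> card \<phi> \<le> c \<and> card Y \<le> z + a \<and>
        Y \<inter> A = {} \<and> vars \<phi> \<subseteq> V \<union> Y \<and>
        (\<forall>\<sigma>. Q \<sigma> \<longleftrightarrow> (\<exists>\<sigma>'. (\<forall>v. v \<notin> Y \<longrightarrow> \<sigma>' v = \<sigma> v) \<and> models \<sigma>' \<phi>))"
    by (intro exI[of _ \<phi>] exI[of _ "Z \<union> Y"] conjI allI iff) (use 1(1-3,5,6) Z(1,2) in auto)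
qed (fact assms(1))

section \<open>Basic encodings and fresh variables\<close>

lemma encodable_cnf:
  assumes "finite \<phi>" "finite V" "vars \<phi> \<subseteq> V"
  shows "encodable V (\<lambda>\<sigma>. models \<sigma> \<phi>) (card \<phi>) 0"
  unfolding encodable_def
proof (intro conjI allI impI)
  fix A :: "nat set"
  have iff: "models \<sigma> \<phi> \<longleftrightarrow> (\<exists>\<sigma>'. (\<forall>v. v \<notin> {} \<longrightarrow> \<sigma>' v = \<sigma> v) \<and> models \<sigma>' \<phi>)" for \<sigma>
    by (simp add: fun_eq_iff[symmetric])
  show "\<exists>\<psi> Y. finite \<psi> \<and> finite Y \<and> card \<psi> \<le> card \<phi> \<and> card Y \<le> 0 \<and>
        Y \<inter> A = {} \<and> vars \<psi> \<subseteq> V \<union> Y \<and>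
        (\<forall>\<sigma>. models \<sigma> \<phi> \<longleftrightarrow> (\<exists>\<sigma>'. (\<forall>v. v \<notin> Y \<longrightarrow> \<sigma>' v = \<sigma> v) \<and> models \<sigma>' \<psi>))"
    by (intro exI[of _ \<phi>] exI[of _ "{}"] conjI allI iff) (use assms in auto)
qed (fact assms(2))

lemma encodable_clause:
  assumes "finite V" "lit_var ` c \<subseteq> V"
  shows "encodable V (\<lambda>\<sigma>. \<exists>l\<in>c. lit_value (\<lambda>v. Some (\<sigma> v)) l = Some True) 1 0"
  using encodable_cnf[of "{c}" V] assms by (simp add: vars_def models_def)

text \<open>There is one clause per falsifying assignment of \<open>V\<close>. Such an assignment is
  identified with its set \<open>S\<close> of true variables, and its clause is falsified by exactly
  the assignments whose true variables in \<open>V\<close> form \<open>S\<close>.\<close>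

lemma encodable_truth_table:
  assumes "finite V" and dep: "\<And>\<sigma> \<sigma>'. (\<And>v. v \<in> V \<Longrightarrow> \<sigma> v = \<sigma>' v) \<Longrightarrow> P \<sigma> = P \<sigma>'"
  shows "encodable V P (2 ^ card V) 0"
proof -
  define F where "F = {S. S \<subseteq> V \<and> \<not> P (\<lambda>v. v \<in> S)}"
  define \<phi> where "\<phi> = (\<lambda>S. Neg ` S \<union> Pos ` (V - S)) ` F"
  have F: "F \<subseteq> Pow V" by (auto simp: F_def)
  then have finF: "finite F" using assms(1) by (meson finite_Pow_iff finite_subset)
  have "card \<phi> \<le> card F" unfolding \<phi>_def by (rule card_image_le[OF finF])
  also have "\<dots> \<le> card (Pow V)" by (rule card_mono) (use F assms in auto)
  finally have card: "card \<phi> \<le> 2 ^ card V" using assms(1) by (simp add: card_Pow)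
  have "models \<sigma> \<phi> \<longleftrightarrow> P \<sigma>" for \<sigma>
  proof -
    have *: "\<not> (\<exists>l\<in>Neg ` S \<union> Pos ` (V - S). lit_value (\<lambda>v. Some (\<sigma> v)) l = Some True) \<longleftrightarrow>
      S = {v \<in> V. \<sigma> v}" if "S \<subseteq> V" for S
      using that by (auto simp: ball_Un)
    have "P (\<lambda>v. v \<in> {v \<in> V. \<sigma> v}) = P \<sigma>" by (rule dep) simp
    moreover have "\<not> models \<sigma> \<phi> \<longleftrightarrow> (\<exists>S\<in>F. \<not> (\<exists>l\<in>Neg ` S \<union> Pos ` (V - S).
        lit_value (\<lambda>v. Some (\<sigma> v)) l = Some True))"
      unfolding models_def \<phi>_def by blast
    moreover have "\<dots> \<longleftrightarrow> (\<exists>S\<in>F. S = {v \<in> V. \<sigma> v})"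
      by (rule bex_cong[OF refl *]) (use F in auto)
    ultimately show ?thesis unfolding F_def by auto
  qed
  then have eq: "(\<lambda>\<sigma>. models \<sigma> \<phi>) = P" by blast
  have "encodable V (\<lambda>\<sigma>. models \<sigma> \<phi>) (card \<phi>) 0"
    by (rule encodable_cnf) (use finF assms(1) in \<open>auto simp: \<phi>_def vars_def F_def\<close>)
  then show ?thesis unfolding eq by (rule encodable_mono) (use card assms(1) in auto)
qed

text \<open>Any injection into the naturals can be shifted beyond the maximum of
  \<open>A\<close>.\<close>

lemma exists_fresh_injection:
  assumes "finite I" "finite (A :: nat set)"
  obtains f :: "'i \<Rightarrow> nat" where "inj_on f I" "f ` I \<inter> A = {}"
proof -
  obtain g :: "'i \<Rightarrow> nat" where g: "inj_on g I"
    using finite_imp_inj_to_nat_seg[OF assms(1)] by blast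
  have "inj_on (\<lambda>i. g i + Suc (Max A)) I" using g by (auto simp: inj_on_def)
  moreover have "(\<lambda>i. g i + Suc (Max A)) ` I \<inter> A = {}"
    using Max_ge[OF assms(2)] by fastforce
  ultimately show ?thesis by (rule that)
qed

section \<open>A counter of linear size\<close>

lemma filter_agree:
  assumes "\<And>v. v \<in> set xs \<Longrightarrow> \<sigma> v = \<sigma>' v"
  shows "length (filter \<sigma> xs) = length (filter \<sigma>' xs)"
  using assms by (metis filter_cong)

text \<open>At most five variables occur, so the truth table has at most \<open>2 ^ 5 = 32\<close>
  clauses. Fewer than three inputs are allowed for the last adder of a chain.\<close>

lemma encodable_adder:
  assumes "length ys \<le> 3"
  shows "encodable (set ys \<union> {s, c})
     (\<lambda>\<sigma>. length (filter \<sigma> ys) \<le> of_bool (\<sigma> s) + 2 * of_bool (\<sigma> c)) 32 0"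
proof -
  have "card (set ys \<union> {s, c}) \<le> 5"
    using card_Un_le[of "set ys" "{s,c}"] card_length[of ys] assms card_insert_le_m1[of 2 "{c}" s]
    by simp
  then have "(2::nat) ^ card (set ys \<union> {s, c}) \<le> 2 ^ 5" by (intro power_increasing) auto
  then have b: "2 ^ card (set ys \<union> {s, c}) \<le> (32::nat)" by simp
  have "encodable (set ys \<union> {s, c})
     (\<lambda>\<sigma>. length (filter \<sigma> ys) \<le> of_bool (\<sigma> s) + 2 * of_bool (\<sigma> c))
     (2 ^ card (set ys \<union> {s, c})) 0"
  proof (rule encodable_truth_table)
    fix \<sigma> \<sigma>' :: "nat \<Rightarrow> bool" assume a: "\<And>v. v \<in> set ys \<union> {s, c} \<Longrightarrow> \<sigma> v = \<sigma>' v"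
    have "length (filter \<sigma> ys) = length (filter \<sigma>' ys)" by (rule filter_agree) (use a in auto)
    then show "(length (filter \<sigma> ys) \<le> of_bool (\<sigma> s) + 2 * of_bool (\<sigma> c)) =
      (length (filter \<sigma>' ys) \<le> of_bool (\<sigma>' s) + 2 * of_bool (\<sigma>' c))" using a by simp
  qed simp
  then show ?thesis by (rule encodable_mono) (use b in auto)
qed

text \<open>
  One bit position of the counter: \<open>s'\<close> is the sum bit and \<open>cs\<close> are the carries.
  Since \<open>at_most\<close> is monotone, the adders need only bound their inputs from above.
\<close>

lemma adder_chain:
  assumes "finite A" "insert s (set xs) \<subseteq> A"
  shows "\<exists>Z s' cs P. finite Z \<and> Z \<inter> A = {} \<and> card Z \<le> 2 * ((length xs + 1) div 2) \<and>
    insert s' (set cs) \<subseteq> insert s (set xs) \<union> Z \<and> length cs = (length xs + 1) div 2 \<and>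
    encodable (insert s (set xs) \<union> Z) P (32 * ((length xs + 1) div 2)) 0 \<and>
    (\<forall>\<sigma>. P \<sigma> \<longrightarrow> of_bool (\<sigma> s) + length (filter \<sigma> xs) \<le>
       of_bool (\<sigma> s') + 2 * length (filter \<sigma> cs)) \<and>
    (\<forall>\<sigma>. \<exists>\<sigma>'. (\<forall>v. v \<notin> Z \<longrightarrow> \<sigma>' v = \<sigma> v) \<and> P \<sigma>' \<and>
       of_bool (\<sigma> s) + length (filter \<sigma> xs) = of_bool (\<sigma>' s') + 2 * length (filter \<sigma>' cs))"
  using assms
proof (induction "length xs" arbitrary: xs s A rule: less_induct)
  case less
  show ?case
  proof (cases "xs = []")
    case True
    \<comment> \<open>With no inputs left, the running bit \<open>s\<close> is itself the sum bit
      and there are no carries.\<close>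
    show ?thesis
      by (rule exI[of _ "{}"], rule exI[of _ s], rule exI[of _ "[]"], rule exI[of _ "\<lambda>_. True"])
        (use True in \<open>auto intro: encodable_True\<close>)
  next
    case False
    \<comment> \<open>The next adder takes the running sum bit together with the next two inputs, or
      with the last one alone.\<close>
    define ys where "ys = s # take 2 xs"
    define zs where "zs = drop 2 xs"
    have len: "length zs < length xs" "(length xs + 1) div 2 = Suc ((length zs + 1) div 2)"
      using False by (cases xs; cases "tl xs"; simp add: zs_def)+
    have filt: "of_bool (\<sigma> s) + length (filter \<sigma> xs) = length (filter \<sigma> ys) + length (filter \<sigma> zs)" for \<sigma>
    proof -
      have "length (filter \<sigma> xs) = length (filter \<sigma> (take 2 xs @ drop 2 xs))" by simp
      then show ?thesis unfolding filter_append ys_def zs_def by simp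
    qed
    have sets: "set ys \<union> set zs = insert s (set xs)"
      unfolding ys_def zs_def using set_append[of "take 2 xs" "drop 2 xs"] by auto
    have ys3: "length ys \<le> 3" by (simp add: ys_def)
    obtain f :: "bool \<Rightarrow> nat" where f: "inj_on f UNIV" "f ` UNIV \<inter> A = {}"
      using exists_fresh_injection[of "UNIV :: bool set" A] less.prems by auto
    define c where "c = f True"
    define u where "u = f False"
    have cu: "c \<noteq> u" "c \<notin> A" "u \<notin> A" using f by (auto simp: c_def u_def inj_on_def)
    \<comment> \<open>The new sum bit \<open>u\<close> becomes the running bit for the remaining
      inputs. Enlarging the avoided set keeps later variables distinct from \<open>c\<close> and
      \<open>u\<close>.\<close>
    have "finite (A \<union> {c,u})" "insert u (set zs) \<subseteq> A \<union> {c,u}" using less.prems sets by auto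
    from less.hyps[OF len(1) this] obtain Z s' cs P where
      Z: "finite Z" "Z \<inter> (A \<union> {c,u}) = {}" "card Z \<le> 2 * ((length zs + 1) div 2)"
      "insert s' (set cs) \<subseteq> insert u (set zs) \<union> Z" "length cs = (length zs + 1) div 2"
      and enc: "encodable (insert u (set zs) \<union> Z) P (32 * ((length zs + 1) div 2)) 0"
      and sound: "\<forall>\<sigma>. P \<sigma> \<longrightarrow> of_bool (\<sigma> u) + length (filter \<sigma> zs) \<le>
         of_bool (\<sigma> s') + 2 * length (filter \<sigma> cs)"
      and complete: "\<forall>\<sigma>. \<exists>\<sigma>'. (\<forall>v. v \<notin> Z \<longrightarrow> \<sigma>' v = \<sigma> v) \<and> P \<sigma>' \<and>
         of_bool (\<sigma> u) + length (filter \<sigma> zs) = of_bool (\<sigma>' s') + 2 * length (filter \<sigma>' cs)"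
      by (elim exE conjE) (rule that)
    define P' where "P' \<sigma> \<longleftrightarrow> length (filter \<sigma> ys) \<le> of_bool (\<sigma> u) + 2 * of_bool (\<sigma> c) \<and> P \<sigma>" for \<sigma>
    have enc': "encodable (insert s (set xs) \<union> (Z \<union> {c,u})) P' (32 * ((length xs + 1) div 2)) 0"
      unfolding P'_def
      by (rule encodable_mono[OF encodable_conj[OF encodable_adder[OF ys3, of u c] enc]])
        (use len sets Z in auto)
    have sound': "of_bool (\<sigma> s) + length (filter \<sigma> xs) \<le> of_bool (\<sigma> s') + 2 * length (filter \<sigma> (c # cs))"
      if "P' \<sigma>" for \<sigma>
      using that sound[rule_format, of \<sigma>] unfolding filt P'_def by (auto split: if_splits)
    have complete': "\<exists>\<sigma>'. (\<forall>v. v \<notin> Z \<union> {c,u} \<longrightarrow> \<sigma>' v = \<sigma> v) \<and> P' \<sigma>' \<and>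
       of_bool (\<sigma> s) + length (filter \<sigma> xs) = of_bool (\<sigma>' s') + 2 * length (filter \<sigma>' (c # cs))" for \<sigma>
    proof -
      define m where "m = length (filter \<sigma> ys)"
      have m: "m \<le> 3" unfolding m_def using ys3 le_trans length_filter_le by blast
      \<comment> \<open>The fresh bits receive the binary digits of \<open>m\<close>, so the adder's
        inequality holds with equality.\<close>
      define \<sigma>1 where "\<sigma>1 = \<sigma>(u := odd m, c := 2 \<le> m)"
      have split: "m = of_bool (\<sigma>1 u) + 2 * of_bool (\<sigma>1 c)"
      proof -
        have "m = 0 \<or> m = 1 \<or> m = 2 \<or> m = 3" using m by linarith
        then show ?thesis using cu by (auto simp: \<sigma>1_def)
      qed
      obtain \<sigma>2 where s2: "\<forall>v. v \<notin> Z \<longrightarrow> \<sigma>2 v = \<sigma>1 v" "P \<sigma>2"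
        "of_bool (\<sigma>1 u) + length (filter \<sigma>1 zs) = of_bool (\<sigma>2 s') + 2 * length (filter \<sigma>2 cs)"
        using complete by blast
      have sub: "set ys \<subseteq> A" "set zs \<subseteq> A" using sets less.prems by auto
      have s2cu: "\<sigma>2 c = \<sigma>1 c" "\<sigma>2 u = \<sigma>1 u" using s2(1) Z(2) by auto
      have "\<sigma>2 v = \<sigma> v" if "v \<in> A" for v
      proof -
        have "v \<notin> Z" "v \<noteq> c" "v \<noteq> u" using that Z(2) cu by auto
        then show ?thesis using s2(1) by (simp add: \<sigma>1_def)
      qed
      then have "length (filter \<sigma>2 ys) = m" unfolding m_def
        by (intro filter_agree) (use sub(1) in auto)
      then have P': "P' \<sigma>2" using s2(2) s2cu split by (simp add: P'_def)
      have "length (filter \<sigma>1 zs) = length (filter \<sigma> zs)"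
        by (rule filter_agree) (use sub cu in \<open>auto simp: \<sigma>1_def\<close>)
      then have "of_bool (\<sigma> s) + length (filter \<sigma> xs) = of_bool (\<sigma>2 s') + 2 * length (filter \<sigma>2 (c # cs))"
        using s2(3) s2cu split unfolding filt m_def[symmetric] by simp
      moreover have "\<forall>v. v \<notin> Z \<union> {c,u} \<longrightarrow> \<sigma>2 v = \<sigma> v" using s2(1) by (auto simp: \<sigma>1_def)
      ultimately show ?thesis using P' by blast
    qed
    have "card (Z \<union> {c,u}) \<le> 2 * ((length xs + 1) div 2)"
      using card_Un_le[of Z "{c,u}"] cu(1) Z(3) len(2) by simp
    moreover have "insert s' (set (c # cs)) \<subseteq> insert s (set xs) \<union> (Z \<union> {c,u})"
      using Z(4) sets by auto
    moreover have "length (c # cs) = (length xs + 1) div 2" using Z(5) len(2) by simp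
    moreover have "(Z \<union> {c,u}) \<inter> A = {}" using Z(2) cu by auto
    moreover have "finite (Z \<union> {c,u})" using Z by simp
    ultimately show ?thesis using enc' sound' complete'
      by (intro exI[of _ "Z \<union> {c,u}"] exI[of _ s'] exI[of _ "c # cs"] exI[of _ P'] conjI allI impI)
  qed
qed

text \<open>
  If the inputs add up to \<open>s + 2 S\<close>, the bound \<open>s + 2 S \<le> k\<close> says \<open>S \<le> k div 2\<close> for odd \<open>k\<close>
  and \<open>s + S \<le> k div 2\<close> for even \<open>k\<close>, so comparing with \<open>k\<close> needs no further circuitry.
\<close>

lemma encodable_at_most_list:
  "encodable (set W) (\<lambda>\<sigma>. length (filter \<sigma> W) \<le> k) (96 * length W) (96 * length W)"
proof (induction "length W" arbitrary: W k rule: less_induct)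
  case less
  consider "length W \<le> k" | "k = 0" | "0 < k" "k < length W" by linarith
  then show ?case
  proof cases
    case 1
    have "length (filter \<sigma> W) \<le> k" for \<sigma> using 1 length_filter_le[of \<sigma> W] by linarith
    then have "encodable (set W) (\<lambda>\<sigma>. length (filter \<sigma> W) \<le> k) 0 0" by (intro encodable_True) auto
    then show ?thesis by (rule encodable_mono) auto
  next
    case 2
    have "encodable (\<Union>w\<in>set W. {w}) (\<lambda>\<sigma>. \<forall>w\<in>set W. \<exists>l\<in>{Neg w}. lit_value (\<lambda>v. Some (\<sigma> v)) l = Some True)
        (\<Sum>w\<in>set W. 1) (\<Sum>w\<in>set W. 0)"
      by (intro encodable_Ball encodable_clause) auto
    moreover have "(\<lambda>\<sigma>. \<forall>w\<in>set W. \<exists>l\<in>{Neg w}. lit_value (\<lambda>v. Some (\<sigma> v)) l = Some True) =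
       (\<lambda>\<sigma>. length (filter \<sigma> W) \<le> k)"
      using 2 by (auto simp: fun_eq_iff filter_empty_conv)
    ultimately have "encodable (set W) (\<lambda>\<sigma>. length (filter \<sigma> W) \<le> k) (card (set W)) 0" by simp
    then show ?thesis by (rule encodable_mono) (use card_length[of W] in auto)
  next
    case 3
    then obtain s xs where W: "W = s # xs" by (cases W) auto
    define m where "m = length W"
    \<comment> \<open>An even positive \<open>k\<close> is at least 2, so
      \<open>k < length W\<close> gives \<open>3 \<le> m\<close>. This ensures \<open>b < m\<close>
      in the even case, where the sum bit is kept.\<close>
    have m: "m = length xs + 1" "2 \<le> m" "odd k \<or> 3 \<le> m" using 3 W by (auto simp: m_def)
    define b where "b = (if odd k then m div 2 else m div 2 + 1)"
    \<comment> \<open>Each of the \<open>m div 2\<close> adders costs 32 clauses and 2 variables,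
      and the recursive call costs \<open>96 * b\<close>. As \<open>b\<close> is about half of
      \<open>m\<close>, both totals stay below \<open>96 * m\<close>.\<close>
    have b: "b < m" "32 * (m div 2) + 96 * b \<le> 96 * m" "2 * (m div 2) + 96 * b \<le> 96 * m"
      using m(2,3) by (auto simp: b_def)
    have "encodable (set W) (\<lambda>\<sigma>. length (filter \<sigma> W) \<le> k) (32 * (m div 2) + 96 * b)
      (2 * (m div 2) + 96 * b)"
    proof (rule encodable_project)
      fix A :: "nat set" assume A: "finite A"
      then have "finite (A \<union> set W)" "insert s (set xs) \<subseteq> A \<union> set W" using W by auto
      from adder_chain[OF this] obtain Z s' cs P where
        Z: "finite Z" "Z \<inter> (A \<union> set W) = {}" "card Z \<le> 2 * ((length xs + 1) div 2)"
        "insert s' (set cs) \<subseteq> insert s (set xs) \<union> Z" "length cs = (length xs + 1) div 2"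
        and enc: "encodable (insert s (set xs) \<union> Z) P (32 * ((length xs + 1) div 2)) 0"
        and sound: "\<forall>\<sigma>. P \<sigma> \<longrightarrow> of_bool (\<sigma> s) + length (filter \<sigma> xs) \<le>
          of_bool (\<sigma> s') + 2 * length (filter \<sigma> cs)"
        and complete: "\<forall>\<sigma>. \<exists>\<sigma>'. (\<forall>v. v \<notin> Z \<longrightarrow> \<sigma>' v = \<sigma> v) \<and> P \<sigma>' \<and>
          of_bool (\<sigma> s) + length (filter \<sigma> xs) = of_bool (\<sigma>' s') + 2 * length (filter \<sigma>' cs)"
        by (elim exE conjE) (rule that)
      have filt: "length (filter \<sigma> W) = of_bool (\<sigma> s) + length (filter \<sigma> xs)" for \<sigma>
        by (simp add: W)
      have setW: "insert s (set xs) = set W" by (simp add: W)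
    note Z = Z[folded m(1), unfolded setW] and enc = enc[folded m(1), unfolded setW]
        and sound = sound[folded filt] and complete = complete[folded filt]
      define W' where "W' = (if odd k then cs else s' # cs)"
      have lenW': "length W' = b" using Z(5) by (simp add: W'_def b_def)
      \<comment> \<open>For even \<open>k\<close>, an odd total that is at most \<open>k\<close> is
        at most \<open>k - 1\<close>, so a true sum bit uses up as much of the bound as a carry. For
        odd \<open>k\<close> it always fits.\<close>
      have iff: "of_bool (\<sigma> s') + 2 * length (filter \<sigma> cs) \<le> k \<longleftrightarrow> length (filter \<sigma> W') \<le> k div 2" for \<sigma>
        by (cases "odd k") (auto simp: W'_def elim!: oddE evenE)
      define P' where "P' \<sigma> \<longleftrightarrow> P \<sigma> \<and> length (filter \<sigma> W') \<le> k div 2" for \<sigma>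
      have IH: "encodable (set W') (\<lambda>\<sigma>. length (filter \<sigma> W') \<le> k div 2) (96 * b) (96 * b)"
        using less[of W' "k div 2"] b(1) lenW' by (simp add: m_def)
      have "encodable (set W \<union> Z) P' (32 * (m div 2) + 96 * b) (96 * b)"
        unfolding P'_def
        by (rule encodable_mono[OF encodable_conj[OF enc IH]]) (use Z in \<open>auto simp: W'_def split: if_splits\<close>)
      moreover have proj: "length (filter \<sigma> W) \<le> k \<longleftrightarrow> (\<exists>\<sigma>'. (\<forall>v. v \<notin> Z \<longrightarrow> \<sigma>' v = \<sigma> v) \<and> P' \<sigma>')" for \<sigma>
      proof
        assume "length (filter \<sigma> W) \<le> k"
        moreover obtain \<sigma>' where "\<forall>v. v \<notin> Z \<longrightarrow> \<sigma>' v = \<sigma> v" "P \<sigma>'"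
            "length (filter \<sigma> W) = of_bool (\<sigma>' s') + 2 * length (filter \<sigma>' cs)"
          using spec[OF complete, of \<sigma>] by (elim exE conjE)
        ultimately have "(\<forall>v. v \<notin> Z \<longrightarrow> \<sigma>' v = \<sigma> v) \<and> P' \<sigma>'"
          unfolding P'_def iff[symmetric] by simp
        then show "\<exists>\<sigma>'. (\<forall>v. v \<notin> Z \<longrightarrow> \<sigma>' v = \<sigma> v) \<and> P' \<sigma>'" by (rule exI[of _ \<sigma>'])
      next
        assume "\<exists>\<sigma>'. (\<forall>v. v \<notin> Z \<longrightarrow> \<sigma>' v = \<sigma> v) \<and> P' \<sigma>'"
        then obtain \<sigma>' where s: "\<forall>v. v \<notin> Z \<longrightarrow> \<sigma>' v = \<sigma> v" "P' \<sigma>'" by blast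
        have "length (filter \<sigma> W) = length (filter \<sigma>' W)"
          by (rule filter_agree) (use s Z(2) in auto)
        also have "\<dots> \<le> k" using sound[rule_format, of \<sigma>'] iff[of \<sigma>'] s(2) unfolding P'_def by linarith
        finally show "length (filter \<sigma> W) \<le> k" .
      qed
      ultimately show "\<exists>Z P. finite Z \<and> Z \<inter> A = {} \<and> card Z \<le> 2 * (m div 2) \<and>
          encodable (set W \<union> Z) P (32 * (m div 2) + 96 * b) (96 * b) \<and>
          (\<forall>\<sigma>. length (filter \<sigma> W) \<le> k \<longleftrightarrow> (\<exists>\<sigma>'. (\<forall>v. v \<notin> Z \<longrightarrow> \<sigma>' v = \<sigma> v) \<and> P \<sigma>'))"
        by (intro exI[of _ Z] exI[of _ P'] conjI allI proj) (use Z(1-3) in auto)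
    qed simp
    then show ?thesis by (rule encodable_mono) (use b m_def in auto)
  qed
qed

lemma encodable_at_most:
  assumes "finite W"
  shows "encodable W (\<lambda>\<sigma>. card {w \<in> W. \<sigma> w} \<le> k) (96 * card W) (96 * card W)"
proof -
  obtain ws where ws: "set ws = W" "distinct ws" using finite_distinct_list[OF assms] by blast
  have "card {w \<in> W. \<sigma> w} = length (filter \<sigma> ws)" for \<sigma>
    using ws distinct_card[of "filter \<sigma> ws"] by simp
  then show ?thesis using encodable_at_most_list[of ws k] ws distinct_card[of ws] by simp
qed

section \<open>Assigning blocks to slots\<close>

text \<open>Induction on \<open>card I\<close>. If some nonempty proper subset \<open>S\<close> is
  tight, \<open>S\<close> and its complement are matched separately, the latter outside the
  neighbours of \<open>S\<close>. If there is none, every nonempty proper subset has a surplus, and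
  one element can be matched arbitrarily.\<close>

lemma hall_marriage:
  fixes N :: "'a \<Rightarrow> 'b set"
  assumes "finite I" "\<And>i. i \<in> I \<Longrightarrow> finite (N i)"
    and "\<And>S. S \<subseteq> I \<Longrightarrow> card S \<le> card (\<Union>i\<in>S. N i)"
  shows "\<exists>f. inj_on f I \<and> (\<forall>i\<in>I. f i \<in> N i)"
  using assms
proof (induction "card I" arbitrary: I N rule: less_induct)
  case less
  note fin = less.prems(1) and finN = less.prems(2) and hall = less.prems(3)
  show ?case
  proof (cases "\<exists>S. S \<subset> I \<and> S \<noteq> {} \<and> card S = card (\<Union>i\<in>S. N i)")
    case True
    then obtain S where S: "S \<subset> I" "S \<noteq> {}" "card S = card (\<Union>i\<in>S. N i)" by blast
    have finS: "finite S" using S(1) fin by (meson finite_subset psubset_imp_subset)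
    have "card S < card I" using S(1) fin by (simp add: psubset_card_mono)
    then have "\<exists>f. inj_on f S \<and> (\<forall>i\<in>S. f i \<in> N i)"
      using S(1) finS by (intro less.hyps finN hall) auto
    then obtain f where f: "inj_on f S" "\<And>i. i \<in> S \<Longrightarrow> f i \<in> N i" by blast
    define B where "B = (\<Union>i\<in>S. N i)"
    have "card (I - S) < card I" using S fin by (intro psubset_card_mono) auto
    then have "\<exists>g. inj_on g (I - S) \<and> (\<forall>i\<in>I - S. g i \<in> N i - B)"
    proof (rule less.hyps)
      fix T assume T: "T \<subseteq> I - S"
      have finT: "finite T" using T fin finite_subset by blast
      have "finite (N i - B)" if "i \<in> T" for i using finN[of i] T that by auto
      moreover have "finite (N i)" if "i \<in> S" for i using finN[of i] S(1) that by auto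
      ultimately have finU: "finite (\<Union>i\<in>T. N i - B)" "finite B"
        unfolding B_def using finT finS by blast+
      \<comment> \<open>Hall's condition for \<open>T\<close> follows from the one for
        \<open>T \<union> S\<close> by subtracting the tight set \<open>S\<close>.\<close>
      have "card T + card S = card (T \<union> S)" using T finT finS by (intro card_Un_disjoint[symmetric]) auto
      also have "\<dots> \<le> card (\<Union>i\<in>T \<union> S. N i)" by (rule hall) (use T S(1) in auto)
      also have "(\<Union>i\<in>T \<union> S. N i) = (\<Union>i\<in>T. N i - B) \<union> B" by (auto simp: B_def)
      also have "card \<dots> = card (\<Union>i\<in>T. N i - B) + card B"
        by (rule card_Un_disjoint) (use finU in auto)
      finally show "card T \<le> card (\<Union>i\<in>T. N i - B)" using S(3) by (simp add: B_def)
    qed (use fin finN in auto)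
    then obtain g where g: "inj_on g (I - S)" "\<And>i. i \<in> I - S \<Longrightarrow> g i \<in> N i - B" by blast
    define h where "h i = (if i \<in> S then f i else g i)" for i
    have "f i \<noteq> g j" if "i \<in> S" "j \<in> I - S" for i j
      using f(2)[OF that(1)] g(2)[OF that(2)] that(1) by (auto simp: B_def)
    then have "inj_on h I" using f(1) g(1) unfolding inj_on_def h_def by (metis DiffI)
    moreover have "\<forall>i\<in>I. h i \<in> N i" using f(2) g(2) by (auto simp: h_def)
    ultimately show ?thesis by blast
  next
    case False
    show ?thesis
    proof (cases "I = {}")
      case False
      then obtain i where i: "i \<in> I" by blast
      have "card {i} \<le> card (\<Union>i\<in>{i}. N i)" by (rule hall) (use i in auto)
      then have "N i \<noteq> {}" by auto
      then obtain y where y: "y \<in> N i" by blast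
      have "card (I - {i}) < card I" using i fin by (intro card_Diff1_less)
      then have "\<exists>g. inj_on g (I - {i}) \<and> (\<forall>j\<in>I - {i}. g j \<in> N j - {y})"
      proof (rule less.hyps)
        fix T assume T: "T \<subseteq> I - {i}"
        show "card T \<le> card (\<Union>j\<in>T. N j - {y})"
        proof (cases "T = {}")
          case False
          have TI: "T \<subset> I" using T i by auto
          \<comment> \<open>Since \<open>T\<close> is not tight, it has a surplus of at least one,
            which pays for the removal of \<open>y\<close>.\<close>
          have "card T \<noteq> card (\<Union>j\<in>T. N j)"
            using \<open>\<nexists>S. S \<subset> I \<and> S \<noteq> {} \<and> card S = card (\<Union>i\<in>S. N i)\<close> TI False by blast
          moreover have "card T \<le> card (\<Union>j\<in>T. N j)" by (rule hall) (use TI in auto)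
          ultimately have "card T \<le> card (\<Union>j\<in>T. N j) - 1" by linarith
          also have "\<dots> \<le> card ((\<Union>j\<in>T. N j) - {y})"
            by (metis card_Diff1_le card_Diff_singleton_if diff_le_self order_refl)
          also have "(\<Union>j\<in>T. N j) - {y} = (\<Union>j\<in>T. N j - {y})" by auto
          finally show ?thesis .
        qed simp
      qed (use fin finN in auto)
      then obtain g where g: "inj_on g (I - {i})" "\<And>j. j \<in> I - {i} \<Longrightarrow> g j \<in> N j - {y}" by blast
      have "inj_on (g(i := y)) I"
      proof (rule inj_onI)
        fix a b assume ab: "a \<in> I" "b \<in> I" "(g(i := y)) a = (g(i := y)) b"
        show "a = b"
        proof (cases "a = i \<or> b = i")
          case True
          then show ?thesis using ab g(2)[of a] g(2)[of b] by (auto split: if_splits)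
        next
          case False
          then show ?thesis using ab g(1) by (auto simp: inj_on_def)
        qed
      qed
      moreover have "\<forall>j\<in>I. (g(i := y)) j \<in> N j" using g(2) y by auto
      ultimately show ?thesis by blast
    qed simp
  qed
qed

section \<open>Random hash functions by counting\<close>

text \<open>The quotient of \<open>s ^ s\<close> by \<open>fact s\<close> is a single term of the
  exponential series at \<open>s\<close>, and \<open>exp 1 \<le> 3\<close>.\<close>

lemma power_self_le_fact: "s ^ s \<le> 3 ^ s * fact s"
proof -
  have "(\<Sum>n\<in>{s}. real s ^ n /\<^sub>R fact n) \<le> (\<Sum>n. real s ^ n /\<^sub>R fact n)"
    by (intro sum_le_suminf summable_exp_generic) auto
  then have "real s ^ s / fact s \<le> exp (real s)" by (simp add: exp_def divide_inverse mult.commute)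
  also have "exp (real s) = exp 1 ^ s" using exp_of_nat_mult[of s 1] by simp
  also have "\<dots> \<le> 3 ^ s" by (intro power_mono exp_le) simp
  finally have "real (s ^ s) \<le> real (3 ^ s * fact s)" by (simp add: field_simps)
  then show ?thesis by (simp only: of_nat_le_iff)
qed

text \<open>
  The union bound for three random hash functions: \<open>s\<close> blocks are hashed into a fixed set
  of \<open>s\<close> slots with probability \<open>(s / R)\<^bsup>3 s\<^esup>\<close>.
\<close>

lemma union_bound_term:
  fixes L R k s :: nat
  assumes "36 * L * k \<le> R ^ 2" "s \<le> k"
  shows "(L choose s) * (R choose s) * s ^ (3 * s) * 4 ^ s \<le> R ^ (3 * s)"
proof -
  let ?a = "L choose s" and ?b = "R choose s"
  \<comment> \<open>Two of the three factors \<open>s ^ s\<close> are traded for factorials, which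
    cancel the denominators of the two binomials. The constant 36 is 9 from this trade times the 4
    from \<open>4 ^ s\<close>.\<close>
  have "s ^ s * s ^ s \<le> (3 ^ s * fact s) * (3 ^ s * fact s)"
    by (intro mult_mono power_self_le_fact) auto
  then have "(?a * ?b) * (s ^ s * s ^ s) \<le> (?a * ?b) * ((3 ^ s * fact s) * (3 ^ s * fact s))"
    by (rule mult_left_mono) simp
  also have "\<dots> = 9 ^ s * ((?a * fact s) * (?b * fact s))"
    using power_mult_distrib[of "3::nat" 3 s] by simp
  also have "\<dots> \<le> 9 ^ s * (L ^ s * R ^ s)"
    by (intro mult_left_mono mult_mono binomial_fact_pow) auto
  finally have "(?a * ?b) * (s ^ s * s ^ s) * (s ^ s * 4 ^ s) \<le> 9 ^ s * (L ^ s * R ^ s) * (s ^ s * 4 ^ s)"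
    by (rule mult_right_mono) simp
  also have "\<dots> = (9 * (L * R) * (s * 4)) ^ s" by (simp only: power_mult_distrib mult_ac)
  also have "\<dots> = (36 * L * s * R) ^ s" by (simp add: mult_ac)
  also have "\<dots> \<le> (R ^ 2 * R) ^ s"
  proof (intro power_mono mult_right_mono)
    have "36 * L * s \<le> 36 * L * k" using assms(2) by simp
    then show "36 * L * s \<le> R ^ 2" using assms(1) by linarith
  qed auto
  also have "\<dots> = R ^ (3 * s)" by (simp add: power_mult power2_eq_square power3_eq_cube)
  finally show ?thesis by (simp add: power_mult power3_eq_cube power_mult_distrib mult_ac)
qed

text \<open>The probabilistic argument by counting: among all maps from the \<open>3 * L\<close>
  offers to the \<open>R\<close> slots, fewer than all are bad. The three hash functions are the
  sections \<open>h (_, d)\<close>.\<close>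

lemma exists_expanding_hash:
  fixes k L R :: nat
  assumes R: "k \<le> R" "0 < R" and LkR: "36 * L * k \<le> R ^ 2"
  obtains h :: "nat \<times> nat \<Rightarrow> nat" where "\<And>j d. j < L \<Longrightarrow> d < 3 \<Longrightarrow> h (j, d) < R"
    "\<And>S. S \<subseteq> {..<L} \<Longrightarrow> card S \<le> k \<Longrightarrow> card S \<le> card (h ` (S \<times> {..<3}))"
proof -
  define D where "D = {..<L} \<times> {..<3::nat}"
  define F where "F = (\<Pi>\<^sub>E e\<in>D. {..<R})"
  define B where "B S T = (\<Pi>\<^sub>E e\<in>D. if fst e \<in> S then T else {..<R})" for S T :: "nat set"
  define P where "P m s = {S. S \<subseteq> {..<m::nat} \<and> card S = s}" for m s
  \<comment> \<open>A map is bad if all offers of some \<open>s\<close> blocks lie in a set of only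
    \<open>s\<close> slots. This contains every failure, where the image even has fewer than
    \<open>s\<close> elements.\<close>
  define Bad where "Bad = (\<Union>s\<in>{1..k}. \<Union>S\<in>P L s. \<Union>T\<in>P R s. B S T)"
  have finD: "finite D" by (simp add: D_def)
  have finP: "finite (P m s)" for m s by (rule finite_subset[of _ "Pow {..<m}"]) (auto simp: P_def)
  have cardP: "card (P m s) = m choose s" for m s
    using n_subsets[of "{..<m}" s] by (simp add: P_def)
  have cardF: "card F = R ^ (3 * L)"
    unfolding F_def by (simp add: card_PiE[OF finD]) (simp add: D_def mult.commute)
  have finF: "finite F" unfolding F_def using finD by (intro finite_PiE) auto
  \<comment> \<open>This is the probability \<open>(s / R) ^ (3 * s)\<close> with denominators
    cleared, so that the count stays in the naturals.\<close>
  have cardB: "card (B S T) * R ^ (3 * s) = s ^ (3 * s) * R ^ (3 * L)" if "S \<in> P L s" "T \<in> P R s" for S T s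
  proof -
    have S: "S \<subseteq> {..<L}" "card S = s" "finite S" and T: "card T = s"
      using that finite_subset by (auto simp: P_def)
    have sL: "s \<le> L" using card_mono[OF _ S(1)] S(2) by simp
    have "card (B S T) = (\<Prod>e\<in>D. if fst e \<in> S then s else R)"
      unfolding B_def card_PiE[OF finD] by (rule prod.cong) (auto simp: T)
    also have "\<dots> = (\<Prod>j<L. \<Prod>d<3::nat. if j \<in> S then s else R)"
      unfolding D_def by (subst prod.cartesian_product) (auto intro: prod.cong)
    also have "\<dots> = (\<Prod>j<L. if j \<in> S then s ^ 3 else R ^ 3)" by (rule prod.cong) auto
    also have "\<dots> = (\<Prod>j\<in>{..<L} \<inter> S. s ^ 3) * (\<Prod>j\<in>{..<L} \<inter> - S. R ^ 3)"
      by (simp add: prod.If_cases)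
    also have "{..<L} \<inter> S = S" using S(1) by auto
    also have "{..<L} \<inter> - S = {..<L} - S" by auto
    finally have "card (B S T) = s ^ (3 * s) * R ^ (3 * (L - s))"
      using S by (simp add: card_Diff_subset power_mult[symmetric])
    moreover have "R ^ (3 * (L - s)) * R ^ (3 * s) = R ^ (3 * L)"
      using sL by (simp add: power_add[symmetric] diff_mult_distrib2)
    ultimately show ?thesis by (simp add: mult.assoc)
  qed
  have layer: "real (card (\<Union>S\<in>P L s. \<Union>T\<in>P R s. B S T)) \<le> real (R ^ (3 * L)) * (1 / 4) ^ s"
    if "s \<in> {1..k}" for s
  proof -
    let ?U = "card (\<Union>S\<in>P L s. \<Union>T\<in>P R s. B S T)"
    have "?U \<le> (\<Sum>S\<in>P L s. card (\<Union>T\<in>P R s. B S T))" by (rule card_UN_le[OF finP])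
    also have "\<dots> \<le> (\<Sum>S\<in>P L s. \<Sum>T\<in>P R s. card (B S T))" by (intro sum_mono card_UN_le finP)
    finally have "?U * R ^ (3 * s) \<le> (\<Sum>S\<in>P L s. \<Sum>T\<in>P R s. card (B S T)) * R ^ (3 * s)"
      by simp
    also have "\<dots> = (\<Sum>S\<in>P L s. \<Sum>T\<in>P R s. card (B S T) * R ^ (3 * s))"
      by (simp add: sum_distrib_right)
    also have "\<dots> = (\<Sum>S\<in>P L s. \<Sum>T\<in>P R s. s ^ (3 * s) * R ^ (3 * L))"
      by (intro sum.cong cardB refl)
    also have "\<dots> = (L choose s) * (R choose s) * s ^ (3 * s) * R ^ (3 * L)" by (simp add: cardP)
    finally have "?U * R ^ (3 * s) * 4 ^ s \<le> (L choose s) * (R choose s) * s ^ (3 * s) * R ^ (3 * L) * 4 ^ s"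
      by (rule mult_right_mono) simp
    also have "\<dots> = ((L choose s) * (R choose s) * s ^ (3 * s) * 4 ^ s) * R ^ (3 * L)"
      by (simp add: mult_ac)
    also have "\<dots> \<le> R ^ (3 * s) * R ^ (3 * L)"
      by (intro mult_right_mono union_bound_term[OF LkR]) (use that in auto)
    finally have "R ^ (3 * s) * (?U * 4 ^ s) \<le> R ^ (3 * s) * R ^ (3 * L)" by (simp add: mult_ac)
    then have "?U * 4 ^ s \<le> R ^ (3 * L)" using R(2) by simp
    then have "real (?U * 4 ^ s) \<le> real (R ^ (3 * L))" by (simp only: of_nat_le_iff)
    then show ?thesis by (simp add: field_simps)
  qed
  have "real (card Bad) \<le> real (\<Sum>s\<in>{1..k}. card (\<Union>S\<in>P L s. \<Union>T\<in>P R s. B S T))"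
    unfolding Bad_def of_nat_le_iff by (rule card_UN_le) simp
  also have "\<dots> \<le> (\<Sum>s\<in>{1..k}. real (R ^ (3 * L)) * (1 / 4) ^ s)"
    unfolding of_nat_sum by (intro sum_mono layer)
  also have "\<dots> = real (R ^ (3 * L)) * (\<Sum>s\<in>{1..k}. (1 / 4) ^ s)" by (simp add: sum_distrib_left)
  \<comment> \<open>The factor \<open>4 ^ s\<close> in the union bound makes the layers a geometric
    series whose sum is below one third.\<close>
  also have "\<dots> < real (R ^ (3 * L)) * 1"
  proof (rule mult_strict_left_mono)
    have "(\<Sum>s\<in>{1..k}. (1 / 4 :: real) ^ s) = (1 - (1 / 4) ^ k) / 3"
    proof (induction k)
      case (Suc k)
      have "(\<Sum>s\<in>{1..Suc k}. (1 / 4 :: real) ^ s) = (\<Sum>s\<in>{1..k}. (1 / 4) ^ s) + 1 / 4 * (1 / 4) ^ k"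
        unfolding sum.cl_ivl_Suc power_Suc by simp
      moreover have "(1 - q) / 3 + 1 / 4 * q = (1 - 1 / 4 * q) / 3" for q :: real by (simp add: field_simps)
      ultimately show ?case unfolding Suc power_Suc by (rule trans)
    qed simp
    also have "\<dots> < 1"
    proof -
      have "0 < (1 / 4 :: real) ^ k" by (rule zero_less_power) simp
      moreover have "(1 - q) / 3 < 1" if "0 < q" for q :: real using that by simp
      ultimately show ?thesis by blast
    qed
    finally show "(\<Sum>s\<in>{1..k}. (1 / 4 :: real) ^ s) < 1" .
  qed (use R in simp)
  finally have less: "card Bad < card F" unfolding cardF by simp
  have "Bad \<subseteq> F"
    unfolding Bad_def B_def F_def P_def by (fastforce simp: PiE_iff split: if_splits)
  then have "finite Bad" using finF by (rule finite_subset)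
  then have "\<not> F \<subseteq> Bad" using less card_mono[of Bad F] by auto
  then obtain h where h: "h \<in> F" "h \<notin> Bad" by blast
  have hR: "h (j, d) < R" if "j < L" "d < 3" for j d
    using h(1) that by (auto simp: F_def D_def PiE_iff)
  moreover have "card S \<le> card (h ` (S \<times> {..<3}))" if S: "S \<subseteq> {..<L}" "card S \<le> k" for S
  proof (rule ccontr)
    assume less: "\<not> card S \<le> card (h ` (S \<times> {..<3}))"
    have "h ` (S \<times> {..<3}) \<subseteq> {..<R}" using S hR by auto
    moreover have "card S \<le> card {..<R}" using S R by simp
    \<comment> \<open>The image is enlarged to exactly \<open>card S\<close> slots, which is
      possible because \<open>card S \<le> k \<le> R\<close>.\<close>
    ultimately obtain T where T: "h ` (S \<times> {..<3}) \<subseteq> T" "T \<subseteq> {..<R}" "card T = card S"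
      using exists_subset_between[of "h ` (S \<times> {..<3})" "card S" "{..<R}"] less by auto
    have "h \<in> B S T" using h(1) T(1) unfolding F_def B_def D_def by (auto simp: PiE_iff)
    moreover have "S \<in> P L (card S)" "T \<in> P R (card S)" using S T by (auto simp: P_def)
    moreover have "card S \<in> {1..k}" using less S by auto
    ultimately have "h \<in> Bad" unfolding Bad_def by blast
    with h(2) show False by simp
  qed
  ultimately show thesis by (rule that)
qed

section \<open>The encoding\<close>

text \<open>The \<open>L\<close> blocks have length \<open>t\<close>, and input \<open>i\<close> has
  position \<open>i mod t\<close> in block \<open>i div t\<close>. The clauses \<open>c1\<close> and
  \<open>c2\<close> contribute \<open>n + 3 * n\<close>, the counters run over at most
  \<open>3 * L\<close> selectors and \<open>R * t\<close> wires, and 97 counts these variables once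
  themselves and 96 times inside the counters.\<close>

lemma encodable_at_most_hash:
  fixes h :: "nat \<times> nat \<Rightarrow> nat" and xs :: "nat list"
  assumes hR: "\<And>j d. j < L \<Longrightarrow> d < 3 \<Longrightarrow> h (j, d) < R"
    and expand: "\<And>S. S \<subseteq> {..<L} \<Longrightarrow> card S \<le> k \<Longrightarrow> card S \<le> card (h ` (S \<times> {..<3}))"
    and "0 < t" "distinct xs" and len: "length xs \<le> L * t"
  shows "encodable (set xs) (\<lambda>\<sigma>. card {x \<in> set xs. \<sigma> x} \<le> k)
    (4 * length xs + 96 * (3 * L + R * t)) (97 * (3 * L + R * t))"
proof -
  define n where "n = length xs"
  define D where "D = {..<L} \<times> {..<3::nat}"
  define E where "E = {..<R} \<times> {..<t}"
  have block: "i div t < L" "i mod t < t" if "i < n" for i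
    using that len \<open>0 < t\<close> by (simp_all add: n_def less_mult_imp_div_less)
  have fin: "finite D" "finite E" by (simp_all add: D_def E_def)
  have card_trues: "card {i. i < n \<and> \<sigma> (xs ! i)} = card {x \<in> set xs. \<sigma> x}" for \<sigma>
  proof -
    have "{x \<in> set xs. \<sigma> x} = (!) xs ` {i. i < n \<and> \<sigma> (xs ! i)}"
      by (auto simp: n_def in_set_conv_nth)
    moreover have "inj_on ((!) xs) {i. i < n \<and> \<sigma> (xs ! i)}"
      using \<open>distinct xs\<close> by (auto simp: inj_on_def n_def nth_eq_iff_index_eq)
    ultimately show ?thesis by (simp add: card_image)
  qed
  have "encodable (set xs) (\<lambda>\<sigma>. card {x \<in> set xs. \<sigma> x} \<le> k)
    (4 * n + 96 * (3 * L + R * t)) ((3 * L + R * t) + 96 * (3 * L + R * t))"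
  proof (rule encodable_project)
    fix A :: "nat set" assume A: "finite A"
    \<comment> \<open>Names for the fresh variables: selectors are indexed by offers (left summand),
      wires by slot and position (right summand).\<close>
    define I where "I = Inl ` D \<union> Inr ` E"
    have "finite I" "finite (A \<union> set xs)" using fin A by (auto simp: I_def)
    then obtain f :: "(nat \<times> nat) + (nat \<times> nat) \<Rightarrow> nat" where
      f: "inj_on f I" "f ` I \<inter> (A \<union> set xs) = {}"
      by (rule exists_fresh_injection)
    define Z where "Z = f ` I"
    define sel where "sel j d = f (Inl (j, d))" for j d
    define wire where "wire r p = f (Inr (r, p))" for r p
    define U where "U r = (\<lambda>(j, d). sel j d) ` {e \<in> D. h e = r}" for r
    define W where "W = (\<lambda>(r, p). wire r p) ` E"
    have selZ: "sel j d \<in> Z" if "j < L" "d < 3" for j d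
      using that by (auto simp: Z_def I_def sel_def D_def)
    have wireZ: "wire r p \<in> Z" if "r < R" "p < t" for r p
      using that by (auto simp: Z_def I_def wire_def E_def)
    have sel_inj: "j = j' \<and> d = d'" if "sel j d = sel j' d'" "j < L" "d < 3" "j' < L" "d' < 3" for j d j' d'
      using inj_onD[OF f(1), of "Inl (j, d)" "Inl (j', d')"] that by (auto simp: I_def sel_def D_def)
    have wire_inj: "r = r' \<and> p = p'" if "wire r p = wire r' p'" "r < R" "p < t" "r' < R" "p' < t" for r p r' p'
      using inj_onD[OF f(1), of "Inr (r, p)" "Inr (r', p')"] that by (auto simp: I_def wire_def E_def)
    have xsZ: "xs ! i \<notin> Z" if "i < n" for i
      using f(2) nth_mem[of i xs] that unfolding Z_def n_def by blast
    have UZ: "U r \<subseteq> Z" for r using selZ by (auto simp: U_def D_def)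
    have WZ: "W \<subseteq> Z" using wireZ by (auto simp: W_def E_def)
    have finZ: "finite Z" using \<open>finite I\<close> by (simp add: Z_def)
    have cardD: "card D = 3 * L" and cardE: "card E = R * t"
      by (simp_all add: D_def E_def card_cartesian_product)
    have "card Z \<le> card I" unfolding Z_def using \<open>finite I\<close> by (rule card_image_le)
    also have "\<dots> \<le> card (Inl ` D :: (nat \<times> nat + nat \<times> nat) set) + card (Inr ` E :: (nat \<times> nat + nat \<times> nat) set)"
      unfolding I_def by (rule card_Un_le)
    also have "\<dots> = 3 * L + R * t" by (simp add: card_image cardD cardE)
    finally have cardZ: "card Z \<le> 3 * L + R * t" .

    define c1 where "c1 i = insert (Neg (xs ! i)) ((\<lambda>d. Pos (sel (i div t) d)) ` {..<3})" for i
    define c2 where "c2 i d = {Neg (xs ! i), Neg (sel (i div t) d), Pos (wire (h (i div t, d)) (i mod t))}" for i d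
    define sat where "sat \<sigma> c \<longleftrightarrow> (\<exists>l\<in>c. lit_value (\<lambda>v. Some (\<sigma> v)) l = Some True)"
      for \<sigma> :: "nat \<Rightarrow> bool" and c :: "nat clause"
    define P where "P \<sigma> \<longleftrightarrow> ((\<forall>i\<in>{..<n}. sat \<sigma> (c1 i)) \<and> (\<forall>e\<in>{..<n} \<times> {..<3}. sat \<sigma> (c2 (fst e) (snd e)))) \<and>
      ((\<forall>r\<in>{..<R}. card {v \<in> U r. \<sigma> v} \<le> 1) \<and> card {v \<in> W. \<sigma> v} \<le> k)" for \<sigma>
    have sat_c1: "sat \<sigma> (c1 i) \<longleftrightarrow> (\<sigma> (xs ! i) \<longrightarrow> (\<exists>d<3. \<sigma> (sel (i div t) d)))" for \<sigma> i
      unfolding sat_def c1_def by auto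
    have sat_c2: "sat \<sigma> (c2 i d) \<longleftrightarrow>
      (\<sigma> (xs ! i) \<longrightarrow> \<sigma> (sel (i div t) d) \<longrightarrow> \<sigma> (wire (h (i div t, d)) (i mod t)))" for \<sigma> i d
      unfolding sat_def c2_def by auto
    have finV: "finite (set xs \<union> Z)" using finZ by simp
    have e1: "encodable (\<Union>i\<in>{..<n}. set xs \<union> Z) (\<lambda>\<sigma>. \<forall>i\<in>{..<n}. sat \<sigma> (c1 i)) (\<Sum>i\<in>{..<n}. 1) (\<Sum>i\<in>{..<n}. 0)"
      unfolding sat_def
      by (intro encodable_Ball encodable_clause finV) (use selZ block in \<open>auto simp: c1_def n_def\<close>)
    have e2: "encodable (\<Union>e\<in>{..<n} \<times> {..<3::nat}. set xs \<union> Z) (\<lambda>\<sigma>. \<forall>e\<in>{..<n} \<times> {..<3}. sat \<sigma> (c2 (fst e) (snd e)))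
        (\<Sum>e\<in>{..<n} \<times> {..<3::nat}. 1) (\<Sum>e\<in>{..<n} \<times> {..<3::nat}. 0)"
      unfolding sat_def
      by (intro encodable_Ball encodable_clause finV)
        (use selZ wireZ hR block in \<open>auto simp: c2_def n_def\<close>)
    have e3: "encodable (\<Union>r\<in>{..<R}. U r) (\<lambda>\<sigma>. \<forall>r\<in>{..<R}. card {v \<in> U r. \<sigma> v} \<le> 1)
        (\<Sum>r\<in>{..<R}. 96 * card (U r)) (\<Sum>r\<in>{..<R}. 96 * card (U r))"
      by (intro encodable_Ball encodable_at_most finite_subset[OF UZ finZ]) simp
    have e4: "encodable W (\<lambda>\<sigma>. card {v \<in> W. \<sigma> v} \<le> k) (96 * card W) (96 * card W)"
      by (intro encodable_at_most finite_subset[OF WZ finZ])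
    \<comment> \<open>The fibres of \<open>h\<close> partition the offers, so the slot constraints
      involve at most \<open>3 * L\<close> variables in total.\<close>
    have "(\<Sum>r\<in>{..<R}. card (U r)) \<le> (\<Sum>r\<in>{..<R}. card {e \<in> D. h e = r})"
      unfolding U_def using fin by (intro sum_mono card_image_le) simp
    also have "\<dots> = (\<Sum>r\<in>{..<R}. \<Sum>e\<in>{e \<in> D. h e = r}. 1)" by simp
    also have "\<dots> = (\<Sum>e\<in>D. 1)"
      by (rule sum.group) (use fin hR in \<open>auto simp: D_def\<close>)
    finally have cU: "(\<Sum>r\<in>{..<R}. 96 * card (U r)) \<le> 96 * (3 * L)"
      using cardD by (simp add: sum_distrib_left[symmetric])
    have cW: "card W \<le> R * t" using card_image_le[OF fin(2)] cardE by (simp add: W_def)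
    have "encodable (set xs \<union> Z) P (4 * n + 96 * (3 * L + R * t)) (96 * (3 * L + R * t))"
      unfolding P_def
      by (rule encodable_mono[OF encodable_conj[OF encodable_conj[OF e1 e2] encodable_conj[OF e3 e4]]])
        (use cU cW UZ WZ finV in \<open>auto simp: card_cartesian_product\<close>)
    moreover have proj: "card {x \<in> set xs. \<sigma> x} \<le> k \<longleftrightarrow>
      (\<exists>\<sigma>'. (\<forall>v. v \<notin> Z \<longrightarrow> \<sigma>' v = \<sigma> v) \<and> P \<sigma>')" for \<sigma>
    proof
      assume le: "card {x \<in> set xs. \<sigma> x} \<le> k"
      define T where "T = {i. i < n \<and> \<sigma> (xs ! i)}"
      define J where "J = (\<lambda>i. i div t) ` T"
      have finT: "finite T" by (simp add: T_def)
      have cardT: "card T \<le> k" using le card_trues by (simp add: T_def)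
      have JL: "J \<subseteq> {..<L}" using block by (auto simp: J_def T_def)
      have cardJ: "card J \<le> k" using card_image_le[OF finT] cardT le_trans unfolding J_def by blast
      \<comment> \<open>At most \<open>k\<close> blocks contain a true input, so expansion gives
        Hall's condition for every subset of them, and these blocks receive distinct slots.\<close>
      have "\<exists>s. inj_on s J \<and> (\<forall>j\<in>J. s j \<in> h ` ({j} \<times> {..<3}))"
      proof (rule hall_marriage)
        fix S assume S: "S \<subseteq> J"
        have "card S \<le> card J" by (rule card_mono) (use S finT in \<open>auto simp: J_def\<close>)
        then have "card S \<le> card (h ` (S \<times> {..<3}))" by (intro expand) (use S JL cardJ in auto)
        also have "h ` (S \<times> {..<3}) = (\<Union>j\<in>S. h ` ({j} \<times> {..<3}))" by auto
        finally show "card S \<le> card (\<Union>j\<in>S. h ` ({j} \<times> {..<3}))" .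
      qed (use finT in \<open>auto simp: J_def\<close>)
      then obtain s where s: "inj_on s J" "\<And>j. j \<in> J \<Longrightarrow> s j \<in> h ` ({j} \<times> {..<3})" by blast
      have "\<forall>j\<in>J. \<exists>d. d < 3 \<and> s j = h (j, d)" using s(2) by fastforce
      then obtain \<delta> where \<delta>: "\<And>j. j \<in> J \<Longrightarrow> \<delta> j < 3" "\<And>j. j \<in> J \<Longrightarrow> s j = h (j, \<delta> j)"
        by metis
      have sR: "s j < R" if "j \<in> J" for j using that \<delta> hR JL by auto
      \<comment> \<open>Each block in \<open>J\<close> selects only the offer of its matched slot,
        and a wire is true only if some true input is copied to it.\<close>
      define val where "val e = (case e of Inl (j, d) \<Rightarrow> j \<in> J \<and> d = \<delta> j
        | Inr (r, p) \<Rightarrow> \<exists>i\<in>T. s (i div t) = r \<and> i mod t = p)" for e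
      define \<sigma>' where "\<sigma>' v = (if v \<in> Z then val (inv_into I f v) else \<sigma> v)" for v
      have \<sigma>'_f: "\<sigma>' (f e) = val e" if "e \<in> I" for e
        using that f(1) by (simp add: \<sigma>'_def Z_def)
      have \<sigma>'_sel: "\<sigma>' (sel j d) \<longleftrightarrow> j \<in> J \<and> d = \<delta> j" if "j < L" "d < 3" for j d
        unfolding sel_def using that by (subst \<sigma>'_f) (auto simp: I_def D_def val_def)
      have \<sigma>'_wire: "\<sigma>' (wire r p) \<longleftrightarrow> (\<exists>i\<in>T. s (i div t) = r \<and> i mod t = p)" if "r < R" "p < t" for r p
        unfolding wire_def using that by (subst \<sigma>'_f) (auto simp: I_def E_def val_def)
      have \<sigma>'_xs: "\<sigma>' (xs ! i) = \<sigma> (xs ! i)" if "i < n" for i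
        using xsZ[OF that] by (simp add: \<sigma>'_def)
      have "sat \<sigma>' (c1 i)" if i: "i < n" for i
        unfolding sat_c1
      proof
        assume "\<sigma>' (xs ! i)"
        then have "i div t \<in> J" using i \<sigma>'_xs by (auto simp: J_def T_def)
        then show "\<exists>d<3. \<sigma>' (sel (i div t) d)"
          using \<delta>(1) \<sigma>'_sel[OF block(1)[OF i]] by auto
      qed
      moreover have "sat \<sigma>' (c2 i d)" if i: "i < n" and d: "d < 3" for i d
        unfolding sat_c2
      proof (intro impI)
        assume x: "\<sigma>' (xs ! i)" and sel: "\<sigma>' (sel (i div t) d)"
        have T: "i \<in> T" using x i \<sigma>'_xs by (simp add: T_def)
        have "s (i div t) = h (i div t, d)" using sel \<sigma>'_sel[OF block(1)[OF i] d] \<delta>(2) by auto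
        then show "\<sigma>' (wire (h (i div t, d)) (i mod t))"
          using T \<sigma>'_wire[OF hR[OF block(1)[OF i] d] block(2)[OF i]] by auto
      qed
      moreover have "card {v \<in> U r. \<sigma>' v} \<le> 1" for r
      proof -
        have fU: "finite {v \<in> U r. \<sigma>' v}" using finite_subset[OF UZ finZ] by simp
        have rep: "\<exists>j\<in>J. v = sel j (\<delta> j) \<and> s j = r" if v: "v \<in> U r" "\<sigma>' v" for v
        proof -
          obtain j d where "v = sel j d" "j < L" "d < 3" "h (j, d) = r"
            using v(1) by (auto simp: U_def D_def)
          then show ?thesis using v(2) \<sigma>'_sel \<delta>(2) by auto
        qed
        \<comment> \<open>Two true selectors offering slot \<open>r\<close> belong to blocks matched
          to \<open>r\<close>, and the matching is injective.\<close>
        have "v = v'" if "v \<in> U r" "\<sigma>' v" "v' \<in> U r" "\<sigma>' v'" for v v'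
          using rep[OF that(1,2)] rep[OF that(3,4)] s(1) by (auto dest: inj_onD)
        then show ?thesis using card_le_Suc0_iff_eq[OF fU] by auto
      qed
      moreover have "card {v \<in> W. \<sigma>' v} \<le> k"
      proof -
        have "{v \<in> W. \<sigma>' v} \<subseteq> (\<lambda>i. wire (s (i div t)) (i mod t)) ` T"
          using \<sigma>'_wire by (auto simp: W_def E_def)
        then have "card {v \<in> W. \<sigma>' v} \<le> card T" using finT surj_card_le by blast
        then show ?thesis using cardT by simp
      qed
      ultimately have "P \<sigma>'" unfolding P_def by auto
      then show "\<exists>\<sigma>'. (\<forall>v. v \<notin> Z \<longrightarrow> \<sigma>' v = \<sigma> v) \<and> P \<sigma>'"
        by (intro exI[of _ \<sigma>']) (simp add: \<sigma>'_def)
    next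
      assume "\<exists>\<sigma>'. (\<forall>v. v \<notin> Z \<longrightarrow> \<sigma>' v = \<sigma> v) \<and> P \<sigma>'"
      then obtain \<sigma>' where agree: "\<forall>v. v \<notin> Z \<longrightarrow> \<sigma>' v = \<sigma> v" and "P \<sigma>'" by (elim exE conjE)
      then have C1: "\<And>i. i < n \<Longrightarrow> sat \<sigma>' (c1 i)"
        and C2: "\<And>i d. i < n \<Longrightarrow> d < 3 \<Longrightarrow> sat \<sigma>' (c2 i d)"
        and C3: "\<And>r. r < R \<Longrightarrow> card {v \<in> U r. \<sigma>' v} \<le> 1"
        and C4: "card {v \<in> W. \<sigma>' v} \<le> k"
        unfolding P_def by auto
      define T where "T = {i. i < n \<and> \<sigma> (xs ! i)}"
      have T: "i < n" "\<sigma>' (xs ! i)" if "i \<in> T" for i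
        using that agree xsZ by (auto simp: T_def)
      have "\<forall>i\<in>T. \<exists>d. d < 3 \<and> \<sigma>' (sel (i div t) d)"
        using C1 T unfolding sat_c1 by blast
      \<comment> \<open>The offer is chosen per input and not per block: an arbitrary model may
        select several slots for one block.\<close>
      then obtain \<delta> where \<delta>: "\<And>i. i \<in> T \<Longrightarrow> \<delta> i < 3" "\<And>i. i \<in> T \<Longrightarrow> \<sigma>' (sel (i div t) (\<delta> i))"
        by metis
      define slot where "slot i = h (i div t, \<delta> i)" for i
      have slotR: "slot i < R" if "i \<in> T" for i
        unfolding slot_def using that by (intro hR block \<delta> T)
      have selU: "sel (i div t) (\<delta> i) \<in> {v \<in> U (slot i). \<sigma>' v}" if "i \<in> T" for i
      proof -
        have "(i div t, \<delta> i) \<in> {e \<in> D. h e = slot i}"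
          using \<delta>(1)[OF that] block(1)[OF T(1)[OF that]] by (simp add: D_def slot_def)
        then show ?thesis using \<delta>(2)[OF that] unfolding U_def by force
      qed
      have inj: "inj_on (\<lambda>i. wire (slot i) (i mod t)) T"
      proof (rule inj_onI)
        fix i i' assume i: "i \<in> T" "i' \<in> T" "wire (slot i) (i mod t) = wire (slot i') (i' mod t)"
        have eq: "slot i = slot i'" "i mod t = i' mod t"
          using wire_inj[OF i(3)] i(1,2) slotR block T by blast+
        have fU: "finite {v \<in> U (slot i). \<sigma>' v}" using finite_subset[OF UZ finZ] by simp
        \<comment> \<open>Inputs sharing a wire have true selectors for the same slot. As at most
          one is true, the blocks agree, and the position within the block then determines the
          input.\<close>
        have "sel (i div t) (\<delta> i) = sel (i' div t) (\<delta> i')"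
          using card_le_Suc0_iff_eq[OF fU] C3[OF slotR[OF i(1)]] selU[OF i(1)] selU[OF i(2)] eq(1) by simp
        then have "i div t = i' div t"
          using sel_inj i(1,2) \<delta>(1) block(1) T(1) by blast
        then show "i = i'" using eq(2) by (metis div_mult_mod_eq)
      qed
      have "(\<lambda>i. wire (slot i) (i mod t)) ` T \<subseteq> {v \<in> W. \<sigma>' v}"
      proof
        fix v assume "v \<in> (\<lambda>i. wire (slot i) (i mod t)) ` T"
        then obtain i where i: "i \<in> T" "v = wire (slot i) (i mod t)" by blast
        have "(slot i, i mod t) \<in> E" using slotR[OF i(1)] block(2)[OF T(1)[OF i(1)]] by (simp add: E_def)
        then have "v \<in> W" unfolding W_def i(2) by force
        moreover have "\<sigma>' v"
          using C2[OF T(1)[OF i(1)] \<delta>(1)[OF i(1)]] T(2)[OF i(1)] \<delta>(2)[OF i(1)]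
          unfolding sat_c2 i(2) slot_def by simp
        ultimately show "v \<in> {v \<in> W. \<sigma>' v}" by simp
      qed
      then have "card T \<le> card {v \<in> W. \<sigma>' v}"
        by (intro card_inj_on_le[OF inj]) (use finite_subset[OF WZ finZ] in auto)
      then show "card {x \<in> set xs. \<sigma> x} \<le> k" using C4 card_trues[of \<sigma>] by (simp add: T_def)
    qed
    ultimately show "\<exists>Z P. finite Z \<and> Z \<inter> A = {} \<and> card Z \<le> 3 * L + R * t \<and>
        encodable (set xs \<union> Z) P (4 * n + 96 * (3 * L + R * t)) (96 * (3 * L + R * t)) \<and>
        (\<forall>\<sigma>. card {x \<in> set xs. \<sigma> x} \<le> k \<longleftrightarrow> (\<exists>\<sigma>'. (\<forall>v. v \<notin> Z \<longrightarrow> \<sigma>' v = \<sigma> v) \<and> P \<sigma>'))"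
      by (intro exI[of _ Z] exI[of _ P] conjI allI proj) (use finZ cardZ f(2) in \<open>auto simp: Z_def\<close>)
  qed simp
  then show ?thesis by (rule encodable_mono) (auto simp: n_def)
qed

section \<open>Restriction by a partial assignment\<close>

lemma lit_value_extend:
  assumes "lit_value \<tau> l = Some b" "\<And>v b. \<tau> v = Some b \<Longrightarrow> \<sigma> v = b"
  shows "lit_value (\<lambda>v. Some (\<sigma> v)) l = Some b"
  using assms by (cases l) auto

text \<open>Deleted clauses are satisfied by \<open>\<tau>\<close>, and surviving clauses keep only
  literals undefined under \<open>\<tau>\<close>. A model of the restriction can therefore be
  overridden by \<open>\<tau>\<close>; conversely, a literal true in an extension of
  \<open>\<tau>\<close> is never deleted.\<close>

lemma satisfiable_restrict_cnf_iff:
  "satisfiable (restrict_cnf \<phi> \<tau>) \<longleftrightarrow> (\<exists>\<sigma>. (\<forall>v b. \<tau> v = Some b \<longrightarrow> \<sigma> v = b) \<and> models \<sigma> \<phi>)"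
proof
  assume "satisfiable (restrict_cnf \<phi> \<tau>)"
  then obtain \<sigma>0 where s0: "\<forall>c\<in>restrict_cnf \<phi> \<tau>. \<exists>l\<in>c. lit_value (\<lambda>v. Some (\<sigma>0 v)) l = Some True"
    unfolding satisfiable_def by (elim exE)
  define \<sigma> where "\<sigma> v = (case \<tau> v of Some b \<Rightarrow> b | None \<Rightarrow> \<sigma>0 v)" for v
  have agree: "\<sigma> v = b" if "\<tau> v = Some b" for v b using that by (simp add: \<sigma>_def)
  have "\<exists>l\<in>c. lit_value (\<lambda>v. Some (\<sigma> v)) l = Some True" if c: "c \<in> \<phi>" for c
  proof (cases "\<exists>l\<in>c. lit_value \<tau> l = Some True")
    case True
    then show ?thesis using lit_value_extend[where \<tau> = \<tau> and \<sigma> = \<sigma>, OF _ agree] by blast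
  next
    case False
    then have "{l \<in> c. lit_value \<tau> l \<noteq> Some False} \<in> restrict_cnf \<phi> \<tau>"
      unfolding restrict_cnf_def using c by (intro CollectI exI[of _ c] conjI refl)
    then obtain l where l: "l \<in> c" "lit_value \<tau> l \<noteq> Some False" "lit_value (\<lambda>v. Some (\<sigma>0 v)) l = Some True"
      using bspec[OF s0] by fast
    then have "lit_value \<tau> l = None" using False by (cases "lit_value \<tau> l") auto
    then have "lit_value (\<lambda>v. Some (\<sigma> v)) l = Some True"
      using l(3) by (cases l) (auto simp: \<sigma>_def)
    with l(1) show ?thesis by blast
  qed
  then have "models \<sigma> \<phi>" unfolding models_def by blast
  then show "\<exists>\<sigma>. (\<forall>v b. \<tau> v = Some b \<longrightarrow> \<sigma> v = b) \<and> models \<sigma> \<phi>"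
    by (intro exI[of _ \<sigma>] conjI allI impI agree)
next
  assume "\<exists>\<sigma>. (\<forall>v b. \<tau> v = Some b \<longrightarrow> \<sigma> v = b) \<and> models \<sigma> \<phi>"
  then obtain \<sigma> where agree: "\<forall>v b. \<tau> v = Some b \<longrightarrow> \<sigma> v = b" and m: "models \<sigma> \<phi>" by (elim exE conjE)
  have "\<exists>l\<in>c. lit_value (\<lambda>v. Some (\<sigma> v)) l = Some True" if res: "c \<in> restrict_cnf \<phi> \<tau>" for c
  proof -
    obtain c' where c: "c' \<in> \<phi>" "c = {l \<in> c'. lit_value \<tau> l \<noteq> Some False}"
      using res unfolding restrict_cnf_def by blast
    obtain l where l: "l \<in> c'" "lit_value (\<lambda>v. Some (\<sigma> v)) l = Some True"
      using m c(1) unfolding models_def by blast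
    have "lit_value \<tau> l \<noteq> Some False" using lit_value_extend[of \<tau> l False \<sigma>] agree l(2) by auto
    then show ?thesis using l c(2) by blast
  qed
  then show "satisfiable (restrict_cnf \<phi> \<tau>)"
    unfolding satisfiable_def by (intro exI[of _ \<sigma>] ballI)
qed

lemma encodes_at_most:
  assumes enc: "encodable (set xs) (\<lambda>\<sigma>. card {x \<in> set xs. \<sigma> x} \<le> k) c a" and "distinct xs"
  shows "\<exists>\<phi> Y. encodes \<phi> xs Y (at_most k) \<and> card \<phi> \<le> c \<and> card Y \<le> a"
proof -
  obtain \<phi> Y where 1: "finite \<phi>" "finite Y" "card \<phi> \<le> c" "card Y \<le> a" "Y \<inter> set xs = {}"
    "vars \<phi> \<subseteq> set xs \<union> Y"
    and iff: "\<forall>\<sigma>. card {x \<in> set xs. \<sigma> x} \<le> k \<longleftrightarrow>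
      (\<exists>\<sigma>'. (\<forall>v. v \<notin> Y \<longrightarrow> \<sigma>' v = \<sigma> v) \<and> models \<sigma>' \<phi>)"
    by (rule encodableE[OF enc finite_set])
  have main: "at_most k (map (\<lambda>x. the (\<tau> x)) xs) \<longleftrightarrow> satisfiable (restrict_cnf \<phi> \<tau>)"
    if dom: "dom \<tau> = set xs" for \<tau>
  proof -
    \<comment> \<open>Outside \<open>set xs\<close> the value of \<open>\<rho>\<close> is
      unspecified. This is harmless, since \<open>\<phi>\<close> mentions only inputs and
      \<open>Y\<close>, and the values on \<open>Y\<close> are free.\<close>
    define \<rho> where "\<rho> v = the (\<tau> v)" for v
    have \<tau>: "\<tau> v = Some b \<longleftrightarrow> v \<in> set xs \<and> b = \<rho> v" for v b
      unfolding dom[symmetric] \<rho>_def by (cases "\<tau> v") (auto simp: domIff)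
    have "card {i. i < length xs \<and> \<rho> (xs ! i)} = length (filter \<rho> xs)"
      by (simp add: length_filter_conv_card)
    also have "\<dots> = card {x \<in> set xs. \<rho> x}"
      using distinct_card[of "filter \<rho> xs"] \<open>distinct xs\<close> by simp
    finally have "at_most k (map \<rho> xs) \<longleftrightarrow> card {x \<in> set xs. \<rho> x} \<le> k"
      unfolding at_most_def by (simp cong: conj_cong)
    also have "\<dots> \<longleftrightarrow> (\<exists>\<sigma>'. (\<forall>v. v \<notin> Y \<longrightarrow> \<sigma>' v = \<rho> v) \<and> models \<sigma>' \<phi>)" by (rule spec[OF iff])
    also have "\<dots> \<longleftrightarrow> (\<exists>\<sigma>. (\<forall>v b. \<tau> v = Some b \<longrightarrow> \<sigma> v = b) \<and> models \<sigma> \<phi>)"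
    proof
      assume "\<exists>\<sigma>'. (\<forall>v. v \<notin> Y \<longrightarrow> \<sigma>' v = \<rho> v) \<and> models \<sigma>' \<phi>"
      then obtain \<sigma>' where s: "\<forall>v. v \<notin> Y \<longrightarrow> \<sigma>' v = \<rho> v" "models \<sigma>' \<phi>" by (elim exE conjE)
      have "\<sigma>' v = b" if "\<tau> v = Some b" for v b
      proof -
        have "v \<notin> Y" "b = \<rho> v" using that 1(5) unfolding \<tau> by auto
        then show ?thesis using s(1) by simp
      qed
      with s(2) show "\<exists>\<sigma>. (\<forall>v b. \<tau> v = Some b \<longrightarrow> \<sigma> v = b) \<and> models \<sigma> \<phi>"
        by (intro exI[of _ \<sigma>'] conjI allI impI)
    next
      assume "\<exists>\<sigma>. (\<forall>v b. \<tau> v = Some b \<longrightarrow> \<sigma> v = b) \<and> models \<sigma> \<phi>"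
      then obtain \<sigma> where s: "\<forall>v b. \<tau> v = Some b \<longrightarrow> \<sigma> v = b" "models \<sigma> \<phi>" by (elim exE conjE)
      define \<sigma>' where "\<sigma>' v = (if v \<in> Y then \<sigma> v else \<rho> v)" for v
      have "\<sigma> v = \<sigma>' v" if "v \<in> vars \<phi>" for v
      proof (cases "v \<in> Y")
        case False
        then have "\<tau> v = Some (\<rho> v)" using that 1(6) unfolding \<tau> by auto
        then show ?thesis using s(1) False by (simp add: \<sigma>'_def)
      qed (simp add: \<sigma>'_def)
      then have "models \<sigma>' \<phi>" using s(2) models_cong[of \<phi> \<sigma> \<sigma>'] by simp
      then show "\<exists>\<sigma>'. (\<forall>v. v \<notin> Y \<longrightarrow> \<sigma>' v = \<rho> v) \<and> models \<sigma>' \<phi>"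
        by (intro exI[of _ \<sigma>']) (simp add: \<sigma>'_def)
    qed
    also have "\<dots> \<longleftrightarrow> satisfiable (restrict_cnf \<phi> \<tau>)"
      by (rule satisfiable_restrict_cnf_iff[symmetric])
    finally show ?thesis unfolding \<rho>_def .
  qed
  have "encodes \<phi> xs Y (at_most k)"
    unfolding encodes_def using 1 \<open>distinct xs\<close> by (intro conjI allI impI main) auto
  then show ?thesis using 1(3,4) by blast
qed

section \<open>Choice of parameters\<close>

text \<open>The two cube bounds say that \<open>t\<close> is the cube root of the quotient of
  \<open>length xs\<close> by \<open>k\<close>, rounded down. It is positive because
  \<open>k < length xs\<close>.\<close>

lemma encodable_at_most_sublinear:
  assumes "distinct xs" "0 < k" "k < length xs" and cube: "k * t ^ 3 \<le> length xs" "length xs < k * (t + 1) ^ 3"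
  shows "encodable (set xs) (\<lambda>\<sigma>. card {x \<in> set xs. \<sigma> x} \<le> k)
    (4 * length xs + 4656 * (k * t ^ 2)) (4656 * (k * t ^ 2))"
proof -
  define n where "n = length xs"
  define L where "L = n div t + 1"
  \<comment> \<open>With \<open>L \<le> 8 * (k * t ^ 2)\<close>, hashing needs \<open>R ^ 2\<close>
    to be at least \<open>288 * k ^ 2 * t ^ 2\<close>; the choice gives 576 in place of 288.\<close>
  define R where "R = 24 * k * t"
  have t: "0 < t" using assms(3) cube(2) by (cases t) auto
  have "(t + 1) ^ 3 \<le> (2 * t) ^ 3" by (rule power_mono) (use t in auto)
  then have "k * (t + 1) ^ 3 \<le> k * (2 * t) ^ 3" by simp
  then have "n < 8 * (k * t ^ 2) * t" using cube(2) by (simp add: n_def power3_eq_cube power2_eq_square)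
  \<comment> \<open>The bound on \<open>n\<close> is strict, so \<open>n div t\<close> is strictly
    smaller and the extra block in \<open>L\<close> still fits.\<close>
  then have L: "L \<le> 8 * (k * t ^ 2)" using less_mult_imp_div_less unfolding L_def by fastforce
  have "36 * L * k \<le> 36 * (8 * (k * t ^ 2)) * k" using L by simp
  also have "\<dots> \<le> R ^ 2" by (simp add: R_def power2_eq_square)
  finally have LkR: "36 * L * k \<le> R ^ 2" .
  have R: "k \<le> R" "0 < R" using t \<open>0 < k\<close> by (simp_all add: R_def)
  obtain h :: "nat \<times> nat \<Rightarrow> nat" where h: "\<And>j d. j < L \<Longrightarrow> d < 3 \<Longrightarrow> h (j, d) < R"
    "\<And>S. S \<subseteq> {..<L} \<Longrightarrow> card S \<le> k \<Longrightarrow> card S \<le> card (h ` (S \<times> {..<3}))"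
    using exists_expanding_hash[OF R LkR] by blast
  have "n = n div t * t + n mod t" by simp
  also have "\<dots> \<le> n div t * t + t" using t by (intro add_left_mono) (simp add: less_imp_le)
  also have "\<dots> = L * t" by (simp add: L_def)
  finally have "length xs \<le> L * t" by (simp add: n_def)
  from encodable_at_most_hash[OF h t assms(1) this]
  have "encodable (set xs) (\<lambda>\<sigma>. card {x \<in> set xs. \<sigma> x} \<le> k)
    (4 * length xs + 96 * (3 * L + R * t)) (97 * (3 * L + R * t))" .
  \<comment> \<open>Selectors and wires contribute 24 each, and \<open>97 * 48 = 4656\<close> is the
    final constant.\<close>
  moreover have "3 * L + R * t \<le> 48 * (k * t ^ 2)" using L by (simp add: R_def power2_eq_square)
  ultimately show ?thesis by (elim encodable_mono) auto
qed

theorem theorem3: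
  "\<exists>C :: real. \<forall>(n :: nat) (k :: nat). n > 0 \<longrightarrow> k > 0 \<longrightarrow>
     (\<forall>xs :: nat list. distinct xs \<longrightarrow> length xs = n \<longrightarrow>
       (\<exists>(\<phi> :: nat cnf) (Y :: nat set).
          encodes \<phi> xs Y (at_most k) \<and>
          real (card \<phi>) \<le> 4 * real n + C * root 3 (real k * real n ^ 2) \<and>
          real (card Y) \<le> C * root 3 (real k * real n ^ 2)))"
proof (intro exI[of _ 4656] allI impI)
  fix n k :: nat and xs :: "nat list"
  assume n: "0 < n" and k: "0 < k" and xs: "distinct xs" "length xs = n"
  let ?r = "root 3 (real k * real n ^ 2)"
  have r: "0 \<le> ?r" by simp
  obtain m where m: "real m \<le> ?r"
    "encodable (set xs) (\<lambda>\<sigma>. card {x \<in> set xs. \<sigma> x} \<le> k) (4 * n + 4656 * m) (4656 * m)"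
  proof (cases "k < n")
    case True
    \<comment> \<open>The predecessor of the least such \<open>T\<close> is the rounded cube root;
      \<open>T\<close> is positive because \<open>n < k * 0 ^ 3\<close> fails.\<close>
    define T where "T = (LEAST T. n < k * T ^ 3)"
    have "n < k * (n + 1) ^ 3"
    proof -
      have "n + 1 \<le> (n + 1) ^ 3" by (rule self_le_power) auto
      also have "\<dots> \<le> k * (n + 1) ^ 3" using k by simp
      finally show ?thesis by simp
    qed
    then have T: "n < k * T ^ 3" unfolding T_def by (rule LeastI)
    then obtain t where t: "T = t + 1" by (cases T) auto
    have "\<not> n < k * t ^ 3" using not_less_Least[of t "\<lambda>T. n < k * T ^ 3"] t by (simp add: T_def)
    then have le: "k * t ^ 3 \<le> n" by simp
    \<comment> \<open>Comparing cubes reduces the bound on \<open>k * t ^ 2\<close> to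
      \<open>k * t ^ 3 \<le> n\<close>.\<close>
    have "(k * t ^ 2) ^ 3 = k * (k * t ^ 3) ^ 2"
      by (simp add: power2_eq_square power3_eq_cube)
    also have "\<dots> \<le> k * n ^ 2" using le by (intro mult_left_mono power_mono) auto
    finally have "real ((k * t ^ 2) ^ 3) \<le> real (k * n ^ 2)" by (simp only: of_nat_le_iff)
    then have "root 3 (real (k * t ^ 2) ^ 3) \<le> ?r"
      by (intro real_root_le_mono) simp_all
    then have "real (k * t ^ 2) \<le> ?r" by (simp add: real_root_power_cancel)
    moreover have "encodable (set xs) (\<lambda>\<sigma>. card {x \<in> set xs. \<sigma> x} \<le> k)
        (4 * n + 4656 * (k * t ^ 2)) (4656 * (k * t ^ 2))"
      using encodable_at_most_sublinear[of xs k t] xs k True le T t by simp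
    ultimately show ?thesis by (rule that)
  next
    case False
    \<comment> \<open>For \<open>n \<le> k\<close> the constraint always holds, so the empty formula
      serves, with \<open>m = 0\<close>.\<close>
    have "card {x \<in> set xs. \<sigma> x} \<le> k" for \<sigma>
    proof -
      have "card {x \<in> set xs. \<sigma> x} \<le> card (set xs)" by (rule card_mono) auto
      then show ?thesis using False xs card_length[of xs] by simp
    qed
    then have "encodable (set xs) (\<lambda>\<sigma>. card {x \<in> set xs. \<sigma> x} \<le> k) 0 0"
      by (intro encodable_True) auto
    then have "encodable (set xs) (\<lambda>\<sigma>. card {x \<in> set xs. \<sigma> x} \<le> k) (4 * n + 4656 * 0) (4656 * 0)"
      by (rule encodable_mono) auto
    then show ?thesis using r by (intro that[of 0]) auto
  qed
  obtain \<phi> Y where "encodes \<phi> xs Y (at_most k)" "card \<phi> \<le> 4 * n + 4656 * m" "card Y \<le> 4656 * m"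
    using encodes_at_most[OF m(2) xs(1)] by blast
  moreover from this(2,3) have "real (card \<phi>) \<le> real (4 * n + 4656 * m)" "real (card Y) \<le> real (4656 * m)"
    by (simp_all only: of_nat_le_iff)
  ultimately show "\<exists>(\<phi> :: nat cnf) (Y :: nat set).
          encodes \<phi> xs Y (at_most k) \<and>
          real (card \<phi>) \<le> 4 * real n + 4656 * ?r \<and>
          real (card Y) \<le> 4656 * ?r"
    using m(1) by (intro exI[of _ \<phi>] exI[of _ Y]) auto
qed

end
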